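(* Let $C=\{f=0\}$ be an isolated plane curve singularity at $0\in\mathbb{C}^2$ defined by a quasi-homogeneous polynomial $f\in\mathbb{C}[x,y]$ of algebraic multiplicity $\nu(f)$. Then, for every integer $k$ with $0\le k<\nu(f)$, $$\frac{\mu^k(f)}{\tau^k(f)}<\frac43.$$
   Context: $\mathcal{O}_2=\mathbb{C}\{x,y\}$ is the ring of germs of holomorphic functions at $0\in\mathbb{C}^2$, $\mathfrak{m}$ is its maximal ideal, and $\mathfrak{m}^0=\mathcal{O}_2$. $\nu(f)$ is the order of vanishing of $f$ at $0$; since $C$ is singular at $0$, $\nu(f)\ge2$. With $j(f)=\langle f_x,f_y\rangle$, $\mu^k(f)=\dim_{\mathbb{C}}\mathcal{O}_2/(\mathfrak{m}^k j(f))$ and $\tau^k(f)=\dim_{\mathbb{C}}\mathcal{O}_2/(\mathfrak{m}^k j(f)+\langle f\rangle)$. A polynomial $f$ is quasi-homogeneous (weighted homogeneous) if there are positive rational weights $w_1,w_2$ such that every monomial $x^iy^j$ occurring in $f$ satisfies $w_1i+w_2j=1$. *)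

theory Defs
  imports
    "HOL-Analysis.Analysis"
    "HOL-Algebra.Ideal_Product"
    "HOL-Algebra.Embedded_Algebras"
    "HOL-Algebra.QuotRing"
    "HOL-Computational_Algebra.Polynomial"
begin

section \<open>Germs at the origin of functions of two complex variables\<close>

text \<open>
  The type \<open>germ\<close> contains the germs of all functions; the holomorphic ones
  are singled out below as the carrier of the ring \<open>O2\<close>.
\<close>

quotient_type germ =
  "complex \<times> complex \<Rightarrow> complex" / "\<lambda>f g. \<forall>\<^sub>F z in nhds (0, 0). f z = g z"
  morphisms rep_germ germ_of
proof (rule equivpI)
  show "reflp (\<lambda>f g :: complex \<times> complex \<Rightarrow> complex. \<forall>\<^sub>F z in nhds (0, 0). f z = g z)"
    by (rule reflpI) simp
  show "symp (\<lambda>f g :: complex \<times> complex \<Rightarrow> complex. \<forall>\<^sub>F z in nhds (0, 0). f z = g z)"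
    by (rule sympI) (simp add: eq_commute)
  show "transp (\<lambda>f g :: complex \<times> complex \<Rightarrow> complex. \<forall>\<^sub>F z in nhds (0, 0). f z = g z)"
    by (rule transpI) (auto elim: eventually_elim2)
qed

instantiation germ :: comm_ring_1
begin

lift_definition zero_germ :: germ is "\<lambda>_. 0" .
lift_definition one_germ :: germ is "\<lambda>_. 1" .
lift_definition plus_germ :: "germ \<Rightarrow> germ \<Rightarrow> germ" is "\<lambda>f g z. f z + g z"
  by (auto elim: eventually_elim2)
lift_definition minus_germ :: "germ \<Rightarrow> germ \<Rightarrow> germ" is "\<lambda>f g z. f z - g z"
  by (auto elim: eventually_elim2)
lift_definition uminus_germ :: "germ \<Rightarrow> germ" is "\<lambda>f z. - f z"
  by (auto elim: eventually_mono)
lift_definition times_germ :: "germ \<Rightarrow> germ \<Rightarrow> germ" is "\<lambda>f g z. f z * g z"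
  by (auto elim: eventually_elim2)

instance
proof
  show "(0::germ) \<noteq> 1"
    by transfer (auto dest: eventually_nhds_x_imp_x)
qed (transfer; simp add: algebra_simps)+

end

lift_definition germ_value :: "germ \<Rightarrow> complex" is "\<lambda>f. f (0, 0)"
  by (auto dest: eventually_nhds_x_imp_x)

lift_definition germ_const :: "complex \<Rightarrow> germ" is "\<lambda>c _. c" .


section \<open>Partial derivatives\<close>

definition dx :: "(complex \<times> complex \<Rightarrow> complex) \<Rightarrow> complex \<times> complex \<Rightarrow> complex" where
  "dx F = (\<lambda>(x, y). deriv (\<lambda>t. F (t, y)) x)"

definition dy :: "(complex \<times> complex \<Rightarrow> complex) \<Rightarrow> complex \<times> complex \<Rightarrow> complex" where
  "dy F = (\<lambda>(x, y). deriv (\<lambda>t. F (x, t)) y)"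

lemma eventually_dx_cong:
  assumes "\<forall>\<^sub>F z in nhds (0, 0). F z = G z"
  shows "\<forall>\<^sub>F z in nhds (0, 0). dx F z = dx G z"
proof -
  have "\<forall>\<^sub>F w in nhds (0, 0). \<forall>\<^sub>F z in nhds w. F z = G z"
    using assms by (simp add: eventually_eventually)
  then show ?thesis
  proof (rule eventually_mono)
    fix w :: "complex \<times> complex"
    assume w: "\<forall>\<^sub>F z in nhds w. F z = G z"
    obtain x y where xy: "w = (x, y)" by (cases w)
    have "filterlim (\<lambda>t. (t, y)) (nhds w) (nhds x)"
      unfolding xy by (intro tendsto_intros filterlim_ident)
    then have "\<forall>\<^sub>F t in nhds x. F (t, y) = G (t, y)"
      by (rule eventually_compose_filterlim[OF w])
    then have "deriv (\<lambda>t. F (t, y)) x = deriv (\<lambda>t. G (t, y)) x"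
      by (rule deriv_cong_ev) simp
    then show "dx F w = dx G w"
      by (simp add: dx_def xy)
  qed
qed

lemma eventually_dy_cong:
  assumes "\<forall>\<^sub>F z in nhds (0, 0). F z = G z"
  shows "\<forall>\<^sub>F z in nhds (0, 0). dy F z = dy G z"
proof -
  have "\<forall>\<^sub>F w in nhds (0, 0). \<forall>\<^sub>F z in nhds w. F z = G z"
    using assms by (simp add: eventually_eventually)
  then show ?thesis
  proof (rule eventually_mono)
    fix w :: "complex \<times> complex"
    assume w: "\<forall>\<^sub>F z in nhds w. F z = G z"
    obtain x y where xy: "w = (x, y)" by (cases w)
    have "filterlim (\<lambda>t. (x, t)) (nhds w) (nhds y)"
      unfolding xy by (intro tendsto_intros filterlim_ident)
    then have "\<forall>\<^sub>F t in nhds y. F (x, t) = G (x, t)"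
      by (rule eventually_compose_filterlim[OF w])
    then have "deriv (\<lambda>t. F (x, t)) y = deriv (\<lambda>t. G (x, t)) y"
      by (rule deriv_cong_ev) simp
    then show "dy F w = dy G w"
      by (simp add: dy_def xy)
  qed
qed

lift_definition germ_dx :: "germ \<Rightarrow> germ" is dx
  by (rule eventually_dx_cong)

lift_definition germ_dy :: "germ \<Rightarrow> germ" is dy
  by (rule eventually_dy_cong)


section \<open>The ring of germs of holomorphic functions\<close>

text \<open>
  A function is holomorphic near the origin if it is the sum of an (absolutely)
  convergent power series in some polydisc centred at the origin.
\<close>

definition holomorphic_near_0 :: "(complex \<times> complex \<Rightarrow> complex) \<Rightarrow> bool" where
  "holomorphic_near_0 F \<longleftrightarrow>
     (\<exists>c :: nat \<times> nat \<Rightarrow> complex. \<exists>r>0. \<forall>x y. norm x < r \<and> norm y < r \<longrightarrow>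
        ((\<lambda>(i, j). c (i, j) * x ^ i * y ^ j) has_sum F (x, y)) UNIV)"

lemma holomorphic_near_0_const: "holomorphic_near_0 (\<lambda>_. a)"
proof -
  have "((\<lambda>(i, j). (if (i, j) = (0, 0) then a else 0) * x ^ i * y ^ j) has_sum a) UNIV"
    for x y :: complex
  proof -
    have "((\<lambda>(i, j). (if (i, j) = (0, 0) then a else 0) * x ^ i * y ^ j) has_sum a) {(0, 0)}"
      by (rule has_sum_finiteI) auto
    then show ?thesis
      by (subst has_sum_cong_neutral[where T = "{(0, 0)}"]) (auto split: if_splits)
  qed
  then show ?thesis
    unfolding holomorphic_near_0_def
    by (intro exI[of _ "\<lambda>p. if p = (0, 0) then a else 0"] exI[of _ "1::real"]) auto
qed

lemma holomorphic_near_0_add: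
  assumes "holomorphic_near_0 F" and "holomorphic_near_0 G"
  shows "holomorphic_near_0 (\<lambda>z. F z + G z)"
proof -
  obtain c r where c: "r > 0"
    "\<And>x y. norm x < r \<and> norm y < r \<Longrightarrow> ((\<lambda>(i, j). c (i, j) * x ^ i * y ^ j) has_sum F (x, y)) UNIV"
    using assms(1) unfolding holomorphic_near_0_def by blast
  obtain d s where d: "s > 0"
    "\<And>x y. norm x < s \<and> norm y < s \<Longrightarrow> ((\<lambda>(i, j). d (i, j) * x ^ i * y ^ j) has_sum G (x, y)) UNIV"
    using assms(2) unfolding holomorphic_near_0_def by blast
  have "((\<lambda>(i, j). (c (i, j) + d (i, j)) * x ^ i * y ^ j) has_sum (F (x, y) + G (x, y))) UNIV"
    if "norm x < min r s \<and> norm y < min r s" for x y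
    using has_sum_add[OF c(2) d(2), of x y x y] that
    by (simp add: case_prod_unfold algebra_simps)
  then show ?thesis
    unfolding holomorphic_near_0_def using c(1) d(1)
    by (intro exI[of _ "\<lambda>p. c p + d p"] exI[of _ "min r s"]) auto
qed

lemma holomorphic_near_0_mult:
  assumes "holomorphic_near_0 F" and "holomorphic_near_0 G"
  shows "holomorphic_near_0 (\<lambda>z. F z * G z)"
proof -
  obtain c r where c: "r > 0"
    "\<And>x y. norm x < r \<and> norm y < r \<Longrightarrow> ((\<lambda>(i, j). c (i, j) * x ^ i * y ^ j) has_sum F (x, y)) UNIV"
    using assms(1) unfolding holomorphic_near_0_def by blast
  obtain d s where d: "s > 0"
    "\<And>x y. norm x < s \<and> norm y < s \<Longrightarrow> ((\<lambda>(i, j). d (i, j) * x ^ i * y ^ j) has_sum G (x, y)) UNIV"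
    using assms(2) unfolding holomorphic_near_0_def by blast
  define e where "e = (\<lambda>(m, n). \<Sum>(i, j)\<in>{..m} \<times> {..n}. c (i, j) * d (m - i, n - j))"
  have "((\<lambda>(m, n). e (m, n) * x ^ m * y ^ n) has_sum (F (x, y) * G (x, y))) UNIV"
    if xy: "norm x < min r s \<and> norm y < min r s" for x y
  proof -
    define a where "a = (\<lambda>(i, j). c (i, j) * x ^ i * y ^ j)"
    define b where "b = (\<lambda>(i, j). d (i, j) * x ^ i * y ^ j)"
    have a: "(a has_sum F (x, y)) UNIV" and b: "(b has_sum G (x, y)) UNIV"
      using c(2)[of x y] d(2)[of x y] xy by (auto simp: a_def b_def)
    have abs: "(\<lambda>p. norm (a p)) summable_on UNIV" "(\<lambda>p. norm (b p)) summable_on UNIV"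
      using a b by (auto simp: summable_on_iff_abs_summable_on_complex[symmetric]
          intro: has_sum_imp_summable)
    have "(\<lambda>u. norm ((\<lambda>(p, q). a p * b q) u)) summable_on UNIV \<times> UNIV"
      using abs
      by (subst Infinite_Sum.abs_summable_on_Sigma_iff)
         (auto simp: norm_mult abs_mult infsum_cmult_right' intro!: summable_on_cmult_right summable_on_cmult_left)
    then have "(\<lambda>(p, q). a p * b q) summable_on UNIV \<times> UNIV"
      by (simp add: summable_on_iff_abs_summable_on_complex)
    then have ab: "((\<lambda>(p, q). a p * b q) has_sum (F (x, y) * G (x, y))) (UNIV \<times> UNIV)"
      by (intro has_sum_SigmaI[where g = "\<lambda>p. a p * G (x, y)"])
         (auto intro: has_sum_cmult_right[OF b] has_sum_cmult_left[OF a])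
    let ?h = "\<lambda>((m, n), (i, j)). c (i, j) * d (m - i, n - j) * x ^ m * y ^ n"
    let ?S = "Sigma (UNIV :: (nat \<times> nat) set) (\<lambda>(m, n). {..m} \<times> {..n})"
    have key: "a (i, j) * b (m - i, n - j) = c (i, j) * d (m - i, n - j) * x ^ m * y ^ n"
      if "i \<le> m" "j \<le> n" for i j m n
    proof -
      have "x ^ m = x ^ i * x ^ (m - i)" "y ^ n = y ^ j * y ^ (n - j)"
        using that by (simp_all flip: power_add)
      then show ?thesis
        by (simp add: a_def b_def)
    qed
    have "(?h has_sum (F (x, y) * G (x, y))) ?S \<longleftrightarrow>
        ((\<lambda>(p, q). a p * b q) has_sum (F (x, y) * G (x, y))) (UNIV \<times> UNIV)"
      by (rule has_sum_reindex_bij_witness[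
          where i = "\<lambda>((i :: nat, j :: nat), (k, l)). ((i + k, j + l), (i, j))"
            and j = "\<lambda>((m :: nat, n :: nat), (i, j)). ((i, j), (m - i, n - j))"])
         (auto simp: key)
    then have "(?h has_sum (F (x, y) * G (x, y))) ?S"
      using ab by blast
    then have "((\<lambda>p. \<Sum>q\<in>(case p of (m, n) \<Rightarrow> {..m} \<times> {..n}). ?h (p, q))
        has_sum (F (x, y) * G (x, y))) UNIV"
      by (rule has_sum_SigmaD) (auto intro!: has_sum_finite)
    then show ?thesis
      by (simp add: e_def sum_distrib_right case_prod_unfold)
  qed
  then show ?thesis
    unfolding holomorphic_near_0_def using c(1) d(1)
    by (intro exI[of _ e] exI[of _ "min r s"]) auto
qed

definition O2 :: "germ ring" where
  "O2 = \<lparr>carrier = germ_of ` {F. holomorphic_near_0 F},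
         mult = (*), one = 1, zero = 0, add = (+)\<rparr>"

lemma cring_O2: "cring O2"
proof -
  have add: "g + h \<in> carrier O2" if "g \<in> carrier O2" "h \<in> carrier O2" for g h
    using that holomorphic_near_0_add
    by (auto simp: O2_def plus_germ.abs_eq)
  have mult: "g * h \<in> carrier O2" if "g \<in> carrier O2" "h \<in> carrier O2" for g h
    using that holomorphic_near_0_mult
    by (auto simp: O2_def times_germ.abs_eq)
  have const: "germ_const a \<in> carrier O2" for a
    by (auto simp: O2_def germ_const.abs_eq holomorphic_near_0_const)
  have eqs: "germ_const 0 = 0" "germ_const 1 = 1" "germ_const (-1) * g = - g" for g
    by (transfer; simp)+
  have uminus: "\<exists>h \<in> carrier O2. h + g = 0" if "g \<in> carrier O2" for g
    using mult[OF const[of "-1"] that] by (intro bexI[of _ "- g"]) (simp_all add: eqs)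
  moreover have "0 \<in> carrier O2" "1 \<in> carrier O2"
    using const[of 0] const[of 1] by (simp_all add: eqs)
  ultimately show ?thesis
    using add mult
    by (intro cringI abelian_groupI comm_monoidI) (simp_all add: O2_def algebra_simps)
qed

definition max_ideal :: "germ set" where
  "max_ideal = {g \<in> carrier O2. germ_value g = 0}"

text \<open>The complex dimension of the quotient \<open>O2 Quot I\<close>, for an ideal \<open>I\<close> of \<open>O2\<close>; the
  ground field is the image of the constant germs.\<close>

definition quot_dim :: "germ set \<Rightarrow> nat" where
  "quot_dim I = (ring.dim (O2 Quot I) over range (\<lambda>c. I +>\<^bsub>O2\<^esub> germ_const c)) (carrier (O2 Quot I))"

definition jacobian_ideal :: "germ \<Rightarrow> germ set" where
  "jacobian_ideal g = Idl\<^bsub>O2\<^esub> {germ_dx g, germ_dy g}"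

text \<open>\<open>ideals_set O2\<close> is the monoid of ideals under multiplication, with unit \<open>carrier O2\<close>.\<close>

definition max_jacobian :: "nat \<Rightarrow> germ \<Rightarrow> germ set" where
  "max_jacobian k g = (max_ideal [^]\<^bsub>ideals_set O2\<^esub> k) \<cdot>\<^bsub>O2\<^esub> jacobian_ideal g"

definition milnor :: "nat \<Rightarrow> germ \<Rightarrow> nat" where
  "milnor k g = quot_dim (max_jacobian k g)"

definition tjurina :: "nat \<Rightarrow> germ \<Rightarrow> nat" where
  "tjurina k g = quot_dim (max_jacobian k g <+>\<^bsub>O2\<^esub> Idl\<^bsub>O2\<^esub> {g})"


section \<open>Plane curves defined by polynomials\<close>

text \<open>
  A polynomial in \<open>x, y\<close> is represented as a polynomial in \<open>y\<close> whose coefficients are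
  polynomials in \<open>x\<close>.
\<close>

definition coeff2 :: "complex poly poly \<Rightarrow> nat \<Rightarrow> nat \<Rightarrow> complex" where
  "coeff2 f i j = Polynomial.coeff (Polynomial.coeff f j) i"

definition eval2 :: "complex poly poly \<Rightarrow> complex \<times> complex \<Rightarrow> complex" where
  "eval2 f = (\<lambda>(x, y). poly (poly f [:y:]) x)"

definition quasi_homogeneous :: "complex poly poly \<Rightarrow> bool" where
  "quasi_homogeneous f \<longleftrightarrow>
     (\<exists>w\<^sub>1 w\<^sub>2 :: rat. w\<^sub>1 > 0 \<and> w\<^sub>2 > 0 \<and>
        (\<forall>i j. coeff2 f i j \<noteq> 0 \<longrightarrow> w\<^sub>1 * of_nat i + w\<^sub>2 * of_nat j = 1))"

definition vanishing_order :: "complex poly poly \<Rightarrow> nat" where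
  "vanishing_order f = (LEAST n. \<exists>i j. i + j = n \<and> coeff2 f i j \<noteq> 0)"

definition singular_locus :: "(complex \<times> complex \<Rightarrow> complex) \<Rightarrow> (complex \<times> complex) set" where
  "singular_locus F = {z. F z = 0 \<and> dx F z = 0 \<and> dy F z = 0}"

definition isolated_curve_singularity :: "complex poly poly \<Rightarrow> bool" where
  "isolated_curve_singularity f \<longleftrightarrow> (0, 0) isolated_in singular_locus (eval2 f)"

end

theory Submission
  imports
    Defs
    "HOL-Computational_Algebra.Fundamental_Theorem_Algebra"
    "HOL-Computational_Algebra.Polynomial_Factorial"
    "HOL-Computational_Algebra.Field_as_Ring"
begin

text \<open>
  Write \<open>P = f\<^sub>x\<close>, \<open>Q = f\<^sub>y\<close>, \<open>n = \<nu>(f) - 1\<close>, so that \<open>k \<le> n\<close> and \<open>P, Q \<in> \<mm>\<^sup>n\<close>. By Euler's identity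
  \<open>f = w\<^sub>1 x P + w\<^sub>2 y Q\<close>, the products \<open>x\<^sup>i y\<^sup>j f\<close> with \<open>i + j \<ge> k - 1\<close> lie in \<open>\<mm>\<^sup>k j(f)\<close>, whence
  \<open>\<mu>\<^sup>k - \<tau>\<^sup>k \<le> k (k - 1) / 2\<close>. On the other hand \<open>\<mm>\<^sup>k j(f)\<close> is spanned modulo \<open>\<mm>\<^sup>2\<^sup>n\<close> by the products
  \<open>x\<^sup>i y\<^sup>j P\<close> and \<open>x\<^sup>i y\<^sup>j Q\<close> with \<open>k \<le> i + j < n\<close>, and counting dimensions in \<open>\<O>\<^sub>2 / \<mm>\<^sup>2\<^sup>n\<close> gives
  \<open>\<mu>\<^sup>k \<ge> n\<^sup>2 + k\<^sup>2 + k\<close>. Together these yield \<open>4 (\<mu>\<^sup>k - \<tau>\<^sup>k) < \<mu>\<^sup>k\<close>; no exact value of \<open>\<mu>\<^sup>k\<close> or \<open>\<tau>\<^sup>k\<close> is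
  needed. Finiteness of the dimensions comes from a weighted Nullstellensatz: the weighted scaling of
  the plane shows that the origin is the only common zero of \<open>P\<close> and \<open>Q\<close>, and homogenizing Bezout
  identities for \<open>P(1, y), Q(1, y)\<close> and for \<open>P(x, 1), Q(x, 1)\<close> puts powers of \<open>x\<close> and \<open>y\<close> into \<open>j(f)\<close>.
\<close>

section \<open>Constant germs and the complex vector space structure on germs\<close>

lemma germ_const_simps:
  "germ_const 0 = 0" "germ_const 1 = 1"
  "germ_const (a + b) = germ_const a + germ_const b"
  "germ_const (a * b) = germ_const a * germ_const b"
  by (transfer; simp)+

interpretation germ: vector_space "\<lambda>c g. germ_const c * g"
  by unfold_locales (simp_all add: germ_const_simps algebra_simps)

interpretation O2: cring O2
  by (rule cring_O2)

lemma O2_ops [simp]: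
  "(\<otimes>\<^bsub>O2\<^esub>) = (*)" "(\<oplus>\<^bsub>O2\<^esub>) = (+)" "\<one>\<^bsub>O2\<^esub> = 1" "\<zero>\<^bsub>O2\<^esub> = 0"
  by (simp_all add: O2_def)

lemma O2_add: "g \<in> carrier O2 \<Longrightarrow> h \<in> carrier O2 \<Longrightarrow> g + h \<in> carrier O2"
  using O2.a_closed by simp

lemma O2_mult: "g \<in> carrier O2 \<Longrightarrow> h \<in> carrier O2 \<Longrightarrow> g * h \<in> carrier O2"
  using O2.m_closed by simp

lemma O2_0: "0 \<in> carrier O2" and O2_1: "1 \<in> carrier O2"
  using O2.zero_closed O2.one_closed by simp_all

lemma O2_const: "germ_const c \<in> carrier O2"
  by (auto simp: O2_def germ_const.abs_eq holomorphic_near_0_const)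

lemma O2_power: "g \<in> carrier O2 \<Longrightarrow> g ^ n \<in> carrier O2"
  by (induction n) (auto intro: O2_mult O2_1)

lemma O2_sum: "(\<And>a. a \<in> A \<Longrightarrow> g a \<in> carrier O2) \<Longrightarrow> sum g A \<in> carrier O2"
  by (induction A rule: infinite_finite_induct) (auto intro: O2_add O2_0)

lemmas O2_closed = O2_add O2_mult O2_0 O2_1 O2_const O2_power O2_sum

lemma O2_subspace: "germ.subspace (carrier O2)"
  by (auto simp: germ.subspace_def intro: O2_closed)

lemma O2_ideal_subspace:
  assumes "ideal I O2" shows "germ.subspace I"
proof -
  interpret ideal I O2 by fact
  show ?thesis
    using I_l_closed[OF _ O2_const] a_closed zero_closed
    by (auto simp: germ.subspace_def)
qed

section \<open>Codimension of ideals\<close>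

text \<open>Each \<open>v a\<close> is congruent modulo \<open>I\<close> to some \<open>b a\<close>
  in \<open>span B\<close>, and independence modulo \<open>I\<close> passes to the
  \<open>b a\<close>; the exchange lemma then compares cardinalities. Lower bounds for
  \<open>codim\<close> come from here.\<close>

lemma (in vector_space) card_le_card_spanning_mod:
  assumes "subspace I" "finite B" "finite A"
    and span: "\<And>a. a \<in> A \<Longrightarrow> v a \<in> span (B \<union> I)"
    and indep: "\<And>c. (\<Sum>a\<in>A. scale (c a) (v a)) \<in> I \<Longrightarrow> \<forall>a\<in>A. c a = 0"
  shows "card A \<le> card B"
proof -
  have "\<exists>b. b \<in> span B \<and> v a - b \<in> I" if "a \<in> A" for a
  proof -
    have "v a \<in> {x + y |x y. x \<in> span B \<and> y \<in> I}"
      using span[OF that] span_eq_iff[THEN iffD2, OF assms(1)] by (simp add: span_Un)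
    then show ?thesis by force
  qed
  then obtain b where b: "\<And>a. a \<in> A \<Longrightarrow> b a \<in> span B" "\<And>a. a \<in> A \<Longrightarrow> v a - b a \<in> I"
    by metis
  have ind: "\<forall>a\<in>A. c a = 0" if "(\<Sum>a\<in>A. scale (c a) (b a)) = 0" for c
  proof (rule indep)
    have "(\<Sum>a\<in>A. scale (c a) (v a)) = (\<Sum>a\<in>A. scale (c a) (v a - b a))"
      using that by (simp add: scale_right_diff_distrib sum_subtractf)
    also have "\<dots> \<in> I"
      by (intro subspace_sum subspace_scale assms b)
    finally show "(\<Sum>a\<in>A. scale (c a) (v a)) \<in> I" .
  qed
  have inj: "inj_on b A"
  proof (rule inj_onI, rule ccontr)
    fix a a' assume a: "a \<in> A" "a' \<in> A" "b a = b a'" "a \<noteq> a'"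
    \<comment> \<open>A repeated value \<open>b a = b a'\<close> would be a nontrivial relation with
      coefficients 1 and -1.\<close>
    let ?c = "\<lambda>x. (if x = a then 1 else 0) - (if x = a' then 1 else 0) :: 'a"
    have "(\<Sum>x\<in>A. scale (?c x) (b x)) =
        (\<Sum>x\<in>A. if x = a then b x else 0) - (\<Sum>x\<in>A. if x = a' then b x else 0)"
      by (simp add: scale_left_diff_distrib sum_subtractf if_distrib[of "\<lambda>t. scale t _"] cong: if_cong)
    also have "\<dots> = 0" using a \<open>finite A\<close> by simp
    finally have "\<forall>x\<in>A. ?c x = 0" by (rule ind[of ?c])
    then have "?c a = 0" using a by blast
    then show False using a by simp
  qed
  have "independent (b ` A)"
  proof (rule independent_if_scalars_zero)
    show "finite (b ` A)" using \<open>finite A\<close> by simp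
    fix f x assume f: "(\<Sum>x\<in>b ` A. scale (f x) x) = 0" and x: "x \<in> b ` A"
    have "(\<Sum>a\<in>A. scale (f (b a)) (b a)) = 0"
      using f by (simp add: sum.reindex[OF inj])
    then show "f x = 0" using ind[of "f \<circ> b"] x by auto
  qed
  then have "card (b ` A) \<le> card B"
    using independent_span_bound[OF assms(2)] b by blast
  then show ?thesis by (simp add: card_image inj)
qed

definition finite_codim :: "germ set \<Rightarrow> bool" where
  "finite_codim I \<longleftrightarrow> (\<exists>B. finite B \<and> B \<subseteq> carrier O2 \<and> carrier O2 \<subseteq> germ.span (B \<union> I))"

text \<open>Minimality over spanning sets makes upper bounds immediate; that a minimal spanning set is
  independent modulo \<open>I\<close> is only used to identify \<open>codim\<close> with \<open>quot_dim\<close>.\<close>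

definition codim :: "germ set \<Rightarrow> nat" where
  "codim I = (LEAST n. \<exists>B. finite B \<and> card B = n \<and> B \<subseteq> carrier O2 \<and>
     carrier O2 \<subseteq> germ.span (B \<union> I))"

lemma codim_le:
  assumes "finite B" "B \<subseteq> carrier O2" "carrier O2 \<subseteq> germ.span (B \<union> I)"
  shows "codim I \<le> card B"
  unfolding codim_def by (rule Least_le) (use assms in blast)

lemma codim_obtain:
  assumes "finite_codim I"
  obtains B where "finite B" "card B = codim I" "B \<subseteq> carrier O2" "carrier O2 \<subseteq> germ.span (B \<union> I)"
proof -
  have "\<exists>B. finite B \<and> card B = codim I \<and> B \<subseteq> carrier O2 \<and> carrier O2 \<subseteq> germ.span (B \<union> I)"
    unfolding codim_def by (rule LeastI_ex) (use assms in \<open>auto simp: finite_codim_def\<close>)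
  then show ?thesis using that by blast
qed

text \<open>Without the finiteness assumption \<open>quot_dim I\<close> would be a \<open>THE\<close> over an empty predicate.\<close>

lemma quot_dim_eq_codim:
  assumes "ideal I O2" "1 \<notin> I" "finite_codim I"
  shows "quot_dim I = codim I"
proof -
  interpret I: ideal I O2 by fact
  define Q where "Q = O2 Quot I"
  define \<pi> where "\<pi> = (\<lambda>g. I +>\<^bsub>O2\<^esub> g)"
  define K where "K = range (\<lambda>c. \<pi> (germ_const c))"
  interpret h: ring_hom_ring O2 Q \<pi>
    unfolding Q_def \<pi>_def by (rule I.rcos_ring_hom_ring)
  note sub = O2_ideal_subspace[OF assms(1)]
  have \<pi>_eq_iff: "\<pi> g = \<pi> h \<longleftrightarrow> g - h \<in> I" if "g \<in> carrier O2" "h \<in> carrier O2" for g h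
  proof -
    have "\<pi> g = \<pi> h \<longleftrightarrow> g \<ominus>\<^bsub>O2\<^esub> h \<in> I"
      unfolding \<pi>_def using O2.quotient_eq_iff_same_a_r_cos[OF assms(1) that] by simp
    moreover have "g \<ominus>\<^bsub>O2\<^esub> h = g - h"
    proof -
      have "(g \<ominus>\<^bsub>O2\<^esub> h) \<oplus>\<^bsub>O2\<^esub> h = g" using that by algebra
      then show ?thesis by (simp add: eq_diff_eq)
    qed
    ultimately show ?thesis by simp
  qed
  have carrQ: "carrier Q = \<pi> ` carrier O2"
    by (auto simp: Q_def \<pi>_def FactRing_def A_RCOSETS_def' image_iff)
  have K: "subfield K Q"
  proof -
    \<comment> \<open>The ground field is first exhibited inside \<open>O2\<close>; as the quotient
      is nontrivial, its image there is again a subfield.\<close>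
    have "subfield (range germ_const) O2"
    proof (rule O2.subfieldI)
      show "subcring (range germ_const) O2"
      proof (rule O2.subcringI')
        show "subring (range germ_const) O2"
        proof (rule O2.subringI)
          show "range germ_const \<subseteq> carrier O2" by (auto intro: O2_const)
          show "\<one>\<^bsub>O2\<^esub> \<in> range germ_const" using germ_const_simps(2) by (metis O2_ops(3) rangeI)
          fix h assume "h \<in> range germ_const"
          then obtain c where c: "h = germ_const c" by auto
          have "germ_const (-c) \<oplus>\<^bsub>O2\<^esub> h = \<zero>\<^bsub>O2\<^esub>"
            by (simp add: c germ_const_simps flip: germ_const_simps)
          then show "\<ominus>\<^bsub>O2\<^esub> h \<in> range germ_const"
            using O2.minus_equality[of "germ_const (-c)" h] O2_const c by auto
        next
          fix g h assume "g \<in> range germ_const" "h \<in> range germ_const"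
          then show "g \<otimes>\<^bsub>O2\<^esub> h \<in> range germ_const" "g \<oplus>\<^bsub>O2\<^esub> h \<in> range germ_const"
            by (auto simp: image_iff simp flip: germ_const_simps)
        qed
      qed
      have inj: "germ_const a = 0 \<longleftrightarrow> a = 0" for a
        by transfer (auto dest: eventually_nhds_x_imp_x)
      show "Units (O2\<lparr>carrier := range germ_const\<rparr>) = range germ_const - {\<zero>\<^bsub>O2\<^esub>}"
      proof -
        have "germ_const a \<in> Units (O2\<lparr>carrier := range germ_const\<rparr>)" if "a \<noteq> 0" for a
          using that by (auto simp: Units_def simp flip: germ_const_simps
              intro!: exI[of _ "inverse a"])
        moreover have "0 \<notin> Units (O2\<lparr>carrier := range germ_const\<rparr>)"
          by (simp add: Units_def)
        ultimately show ?thesis by (auto simp: inj Units_def)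
      qed
    qed
    moreover have "\<one>\<^bsub>Q\<^esub> \<noteq> \<zero>\<^bsub>Q\<^esub>"
      using \<pi>_eq_iff[of 1 0] assms(2) O2_0 O2_1 h.hom_one h.hom_zero by simp
    ultimately have "subfield (\<pi> ` range germ_const) Q"
      by (rule h.img_is_subfield(2))
    then show ?thesis by (simp add: K_def image_image)
  qed
  \<comment> \<open>Linear algebra in \<open>Q\<close> is phrased with lists and the subfield
    \<open>K\<close>; this identity translates it into spans of germs.\<close>
  have Span: "h.S.Span K (map \<pi> Us) = \<pi> ` germ.span (set Us)" if "set Us \<subseteq> carrier O2" for Us
    using that
  proof (induction Us)
    case Nil
    then show ?case using h.hom_zero by simp
  next
    case (Cons u Us)
    have us: "germ.span (set Us) \<subseteq> carrier O2"
      using Cons by (intro germ.span_minimal O2_subspace) auto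
    have u: "u \<in> carrier O2" using Cons by simp
    have hh: "\<pi> (germ_const k) \<otimes>\<^bsub>Q\<^esub> \<pi> u \<oplus>\<^bsub>Q\<^esub> \<pi> v = \<pi> (germ_const k * u + v)" if "v \<in> germ.span (set Us)" for k v
    proof -
      have v: "v \<in> carrier O2" using us that by auto
      show ?thesis
        using h.hom_mult[OF O2_const u] h.hom_add[OF O2_mult[OF O2_const u] v] by simp
    qed
    have "z \<in> h.S.Span K (map \<pi> (u # Us)) \<longleftrightarrow> z \<in> \<pi> ` germ.span (set (u # Us))" for z
    proof -
      have "z \<in> h.S.Span K (map \<pi> (u # Us)) \<longleftrightarrow>
          (\<exists>k. \<exists>v\<in>germ.span (set Us). z = \<pi> (germ_const k * u + v))"
      proof -
        have "h.S.Span K (map \<pi> (u # Us)) = h.S.line_extension K (\<pi> u) (\<pi> ` germ.span (set Us))"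
          using Cons by simp
        then show ?thesis
          using hh by (auto simp: h.S.line_extension_mem_iff K_def)
      qed
      also have "\<dots> \<longleftrightarrow> z \<in> \<pi> ` germ.span (set (u # Us))"
        by (auto simp: germ.span_insert image_iff) (metis add.commute add_diff_cancel diff_add_cancel)+
      finally show ?thesis .
    qed
    then show ?case by blast
  qed
  obtain B where B: "finite B" "card B = codim I" "B \<subseteq> carrier O2" "carrier O2 \<subseteq> germ.span (B \<union> I)"
    using assms(3) by (rule codim_obtain)
  \<comment> \<open>A spanning set of least cardinality has no redundant element: without it the set
    would still span, contradicting \<open>codim_le\<close>.\<close>
  have min: "b \<notin> germ.span ((B - {b}) \<union> I)" if "b \<in> B" for b
  proof
    assume "b \<in> germ.span ((B - {b}) \<union> I)"
    then have "germ.span (insert b ((B - {b}) \<union> I)) = germ.span ((B - {b}) \<union> I)"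
      by (rule germ.span_redundant)
    moreover have "insert b ((B - {b}) \<union> I) = B \<union> I" using that by auto
    ultimately have "codim I \<le> card (B - {b})"
      using B by (intro codim_le) auto
    then show False using B that by (metis card_Diff1_less not_le)
  qed
  have indep: "h.S.independent K (map \<pi> Us)" if "set Us \<subseteq> B" "distinct Us" for Us
    using that
  proof (induction Us)
    case Nil then show ?case by simp
  next
    case (Cons u Us)
    have uc: "u \<in> carrier O2" "set Us \<subseteq> carrier O2" using Cons B by auto
    have "\<pi> u \<notin> h.S.Span K (map \<pi> Us)"
    proof
      assume "\<pi> u \<in> h.S.Span K (map \<pi> Us)"
      then obtain v where v: "v \<in> germ.span (set Us)" "\<pi> u = \<pi> v"
        unfolding Span[OF uc(2)] by auto
      have "v \<in> carrier O2"
        using v uc germ.span_minimal[OF uc(2) O2_subspace] by auto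
      then have "u - v \<in> I" using \<pi>_eq_iff v uc by simp
      then have "u - v \<in> germ.span ((B - {u}) \<union> I)" by (simp add: germ.span_base)
      moreover have "v \<in> germ.span ((B - {u}) \<union> I)"
        using v(1) Cons.prems by (rule_tac set_mp[OF germ.span_mono]) auto
      ultimately have "u \<in> germ.span ((B - {u}) \<union> I)"
        using germ.span_add by fastforce
      then show False using min Cons.prems by auto
    qed
    then show ?case
      using Cons uc h.hom_closed by (auto intro!: h.S.independent.li_Cons)
  qed
  obtain Us where Us: "set Us = B" "distinct Us"
    using finite_distinct_list[OF B(1)] by blast
  have "h.S.Span K (map \<pi> Us) = carrier Q"
  proof -
    have "\<pi> ` germ.span B = \<pi> ` carrier O2"
    proof
      show "\<pi> ` germ.span B \<subseteq> \<pi> ` carrier O2"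
        using germ.span_minimal[OF B(3) O2_subspace] by auto
      show "\<pi> ` carrier O2 \<subseteq> \<pi> ` germ.span B"
      proof
        fix z assume "z \<in> \<pi> ` carrier O2"
        then obtain g where g: "g \<in> carrier O2" "z = \<pi> g" by auto
        then have "g \<in> germ.span (B \<union> I)" using B by auto
        then obtain x y where xy: "g = x + y" "x \<in> germ.span B" "y \<in> I"
          using germ.span_eq_iff[THEN iffD2, OF sub] by (auto simp: germ.span_Un)
        have "x \<in> carrier O2" using xy germ.span_minimal[OF B(3) O2_subspace] by auto
        then have "\<pi> g = \<pi> x" using \<pi>_eq_iff g xy by simp
        then show "z \<in> \<pi> ` germ.span B" using g xy by auto
      qed
    qed
    then show ?thesis using Span[of Us] Us B carrQ by simp
  qed
  then have "h.S.dimension (length (map \<pi> Us)) K (carrier Q)"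
    using h.S.dimension_independent[OF indep[of Us]] Us by simp
  then have "(h.S.dim over K) (carrier Q) = length (map \<pi> Us)"
    by (rule h.S.dimI[OF K])
  also have "\<dots> = codim I" using Us B distinct_card by fastforce
  finally show ?thesis
    by (simp add: quot_dim_def Q_def K_def \<pi>_def)
qed

section \<open>Powers of the maximal ideal\<close>

definition gX :: germ where "gX = germ_of fst"
definition gY :: germ where "gY = germ_of snd"

lemma holomorphic_near_0_monomial: "holomorphic_near_0 (\<lambda>(x, y). x ^ m * y ^ n)"
proof -
  have "((\<lambda>(i, j). (if (i, j) = (m, n) then 1 else 0) * x ^ i * y ^ j) has_sum x ^ m * y ^ n) UNIV"
    for x y :: complex
  proof -
    have "((\<lambda>(i, j). (if (i, j) = (m, n) then 1 else 0) * x ^ i * y ^ j) has_sum x ^ m * y ^ n) {(m, n)}"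
      by (rule has_sum_finiteI) auto
    then show ?thesis
      by (subst has_sum_cong_neutral[where T = "{(m, n)}"]) (auto split: if_splits)
  qed
  then show ?thesis
    unfolding holomorphic_near_0_def
    by (intro exI[of _ "\<lambda>p. if p = (m, n) then 1 else 0"] exI[of _ "1::real"]) auto
qed

lemma gX_in_O2: "gX \<in> carrier O2"
proof -
  have "(\<lambda>(x, y). x ^ 1 * y ^ 0) = (fst :: complex \<times> complex \<Rightarrow> complex)" by auto
  then show ?thesis using holomorphic_near_0_monomial[of 1 0] by (auto simp: gX_def O2_def)
qed

lemma gY_in_O2: "gY \<in> carrier O2"
proof -
  have "(\<lambda>(x, y). x ^ 0 * y ^ 1) = (snd :: complex \<times> complex \<Rightarrow> complex)" by auto
  then show ?thesis using holomorphic_near_0_monomial[of 0 1] by (auto simp: gY_def O2_def)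
qed

text \<open>Comparison with the majorant series of absolute values at the corner
  \<open>(t, t)\<close> of the bidisc, whose sum does not depend on \<open>x\<close> and
  \<open>y\<close>.\<close>

lemma power_series_bidisc_bound:
  fixes c :: "nat \<times> nat \<Rightarrow> complex"
  assumes "(\<lambda>(i, j). norm (c (i, j)) * t ^ i * t ^ j) summable_on UNIV"
    and "norm x \<le> t" "norm y \<le> t"
  shows "(\<lambda>(i, j). c (i, j) * x ^ i * y ^ j) summable_on UNIV"
    and "norm (\<Sum>\<^sub>\<infinity>(i, j). c (i, j) * x ^ i * y ^ j) \<le> (\<Sum>\<^sub>\<infinity>(i, j). norm (c (i, j)) * t ^ i * t ^ j)"
proof -
  have le: "norm ((\<lambda>(i, j). c (i, j) * x ^ i * y ^ j) p) \<le> (\<lambda>(i, j). norm (c (i, j)) * t ^ i * t ^ j) p" for p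
  proof -
    have "norm x ^ i * norm y ^ j \<le> t ^ i * t ^ j" for i j
      using assms(2,3) order_trans[OF norm_ge_zero assms(2)]
      by (intro mult_mono power_mono) auto
    then show ?thesis
      by (auto simp: case_prod_unfold norm_mult norm_power mult.assoc intro!: mult_left_mono)
  qed
  have "(\<lambda>p. norm ((\<lambda>(i, j). c (i, j) * x ^ i * y ^ j) p)) summable_on UNIV"
    by (rule summable_on_comparison_test[OF assms(1)]) (use le in auto)
  then show "(\<lambda>(i, j). c (i, j) * x ^ i * y ^ j) summable_on UNIV"
    by (simp add: summable_on_iff_abs_summable_on_complex)
  then show "norm (\<Sum>\<^sub>\<infinity>(i, j). c (i, j) * x ^ i * y ^ j) \<le> (\<Sum>\<^sub>\<infinity>(i, j). norm (c (i, j)) * t ^ i * t ^ j)"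
    using assms(1) le by (intro norm_infsum_le[OF has_sum_infsum has_sum_infsum]) auto
qed

text \<open>Unconditional summability of complex numbers is absolute, so convergence at the single
  point \<open>(t, t)\<close>, with \<open>t\<close> half of the given radius, supplies a majorant
  on the bidisc of radius \<open>t\<close>.\<close>

lemma holomorphic_near_0_absE:
  assumes "holomorphic_near_0 F"
  obtains c and t :: real where "t > 0" "(\<lambda>(i, j). norm (c (i, j)) * t ^ i * t ^ j) summable_on UNIV"
    "\<And>x y. norm x < t \<Longrightarrow> norm y < t \<Longrightarrow> ((\<lambda>(i, j). c (i, j) * x ^ i * y ^ j) has_sum F (x, y)) UNIV"
proof -
  obtain c r where c: "r > 0"
    "\<And>x y. norm x < r \<and> norm y < r \<Longrightarrow> ((\<lambda>(i, j). c (i, j) * x ^ i * y ^ j) has_sum F (x, y)) UNIV"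
    using assms unfolding holomorphic_near_0_def by blast
  define t where "t = r / 2"
  have t: "t > 0" "t < r" using c(1) by (auto simp: t_def)
  have "(\<lambda>(i, j). c (i, j) * complex_of_real t ^ i * complex_of_real t ^ j) summable_on UNIV"
    using c(2)[of "complex_of_real t" "complex_of_real t"] t by (auto intro: has_sum_imp_summable)
  then have "(\<lambda>p. norm ((\<lambda>(i, j). c (i, j) * complex_of_real t ^ i * complex_of_real t ^ j) p)) summable_on UNIV"
    by (simp add: summable_on_iff_abs_summable_on_complex)
  then have "(\<lambda>(i, j). norm (c (i, j)) * t ^ i * t ^ j) summable_on UNIV"
    using t by (simp add: case_prod_unfold norm_mult norm_power)
  then show ?thesis using that[of t c] c t by auto
qed

lemma holomorphic_near_0_bounded:
  assumes "holomorphic_near_0 F"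
  obtains C r where "C > 0" "r > 0" "\<And>x y. norm x < r \<Longrightarrow> norm y < r \<Longrightarrow> norm (F (x, y)) \<le> C"
proof -
  obtain c t where c: "t > 0" "(\<lambda>(i, j). norm (c (i, j)) * t ^ i * t ^ j) summable_on UNIV"
    "\<And>x y. norm x < t \<Longrightarrow> norm y < t \<Longrightarrow> ((\<lambda>(i, j). c (i, j) * x ^ i * y ^ j) has_sum F (x, y)) UNIV"
    using assms by (rule holomorphic_near_0_absE) blast
  let ?C = "\<Sum>\<^sub>\<infinity>(i, j). norm (c (i, j)) * t ^ i * t ^ j"
  have "norm (F (x, y)) \<le> \<bar>?C\<bar> + 1" if "norm x < t" "norm y < t" for x y
    using power_series_bidisc_bound(2)[OF c(2), of x y] infsumI[OF c(3)[OF that]] that by simp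
  then show ?thesis using that[of "\<bar>?C\<bar> + 1" t] c(1) by auto
qed

text \<open>The power series splits into its constant term, the terms divisible by \<open>x\<close>,
  and the remaining pure powers of \<open>y\<close>. This is why the coordinates generate the
  maximal ideal.\<close>

lemma holomorphic_near_0_divide:
  assumes "holomorphic_near_0 F"
  obtains A B r where "holomorphic_near_0 A" "holomorphic_near_0 B" "r > 0"
    "\<And>x y. norm x < r \<Longrightarrow> norm y < r \<Longrightarrow> F (x, y) = F (0, 0) + x * A (x, y) + y * B (x, y)"
proof -
  obtain c t where t: "t > 0" and abs: "(\<lambda>(i, j). norm (c (i, j)) * t ^ i * t ^ j) summable_on UNIV"
    and F: "\<And>x y. norm x < t \<Longrightarrow> norm y < t \<Longrightarrow> ((\<lambda>(i, j). c (i, j) * x ^ i * y ^ j) has_sum F (x, y)) UNIV"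
    using assms by (rule holomorphic_near_0_absE) blast
  define a where "a = (\<lambda>(i, j). c (Suc i, j))"
  define b where "b = (\<lambda>(i, j). if i = (0::nat) then c (0, Suc j) else 0)"
  \<comment> \<open>\<open>h\<close> sends an index of the quotient series to the index of
    \<open>c\<close> from which its coefficient is taken. The total degree there is larger by one,
    which explains the factor \<open>inverse t\<close> below.\<close>
  have sub: "(\<lambda>p. norm (d p) * t ^ fst p * t ^ snd p) summable_on UNIV"
    if inj: "inj_on h S" and h: "\<And>p. p \<in> S \<Longrightarrow> d p = c (h p) \<and> fst (h p) + snd (h p) = Suc (fst p + snd p)"
      and d0: "\<And>p. p \<notin> S \<Longrightarrow> d p = 0"
    for S and h :: "nat \<times> nat \<Rightarrow> nat \<times> nat" and d :: "nat \<times> nat \<Rightarrow> complex"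
  proof -
    have "(\<lambda>(i, j). norm (c (i, j)) * t ^ i * t ^ j) summable_on h ` S"
      by (rule summable_on_subset_banach[OF abs]) auto
    then have "((\<lambda>(i, j). norm (c (i, j)) * t ^ i * t ^ j) \<circ> h) summable_on S"
      by (simp add: summable_on_reindex[OF inj])
    then have "(\<lambda>p. inverse t * ((\<lambda>(i, j). norm (c (i, j)) * t ^ i * t ^ j) \<circ> h) p) summable_on S"
      by (rule summable_on_cmult_right)
    also have "?this \<longleftrightarrow> (\<lambda>p. norm (d p) * t ^ fst p * t ^ snd p) summable_on UNIV"
    proof (rule summable_on_cong_neutral)
      fix p assume p: "p \<in> S \<inter> UNIV"
      then have "t ^ fst (h p) * t ^ snd (h p) = t * (t ^ fst p * t ^ snd p)"
        using h[of p] by (simp flip: power_add power_Suc)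
      then show "inverse t * ((\<lambda>(i, j). norm (c (i, j)) * t ^ i * t ^ j) \<circ> h) p = norm (d p) * t ^ fst p * t ^ snd p"
        using p h[of p] t by (simp add: case_prod_unfold mult.assoc) 
    qed (use d0 in auto)
    finally show ?thesis .
  qed
  have absa: "(\<lambda>(i, j). norm (a (i, j)) * t ^ i * t ^ j) summable_on UNIV"
    using sub[of "\<lambda>(i, j). (Suc i, j)" UNIV a] by (auto simp: a_def inj_on_def case_prod_unfold)
  have absb: "(\<lambda>(i, j). norm (b (i, j)) * t ^ i * t ^ j) summable_on UNIV"
    using sub[of "\<lambda>(i, j). (i, Suc j)" "{0} \<times> UNIV" b]
    by (auto simp: b_def inj_on_def case_prod_unfold prod_eq_iff if_distrib cong: if_cong)
  define A where "A = (\<lambda>(x, y). \<Sum>\<^sub>\<infinity>(i, j). a (i, j) * x ^ i * y ^ j)"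
  define B where "B = (\<lambda>(x, y). \<Sum>\<^sub>\<infinity>(i, j). b (i, j) * x ^ i * y ^ j)"
  have sA: "((\<lambda>(i, j). a (i, j) * x ^ i * y ^ j) has_sum A (x, y)) UNIV"
    and sB: "((\<lambda>(i, j). b (i, j) * x ^ i * y ^ j) has_sum B (x, y)) UNIV"
    if "norm x < t" "norm y < t" for x y
    using power_series_bidisc_bound(1)[OF absa, of x y] power_series_bidisc_bound(1)[OF absb, of x y] that
    by (simp_all add: A_def B_def)
  have "holomorphic_near_0 A" "holomorphic_near_0 B"
    using sA sB t unfolding holomorphic_near_0_def by blast+
  moreover have "F (x, y) = F (0, 0) + x * A (x, y) + y * B (x, y)" if xy: "norm x < t" "norm y < t" for x y
  proof -
    let ?T = "\<lambda>(i, j). c (i, j) * x ^ i * y ^ j"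
    have c00: "F (0, 0) = c (0, 0)"
    proof -
      have "((\<lambda>(i, j). c (i, j) * 0 ^ i * 0 ^ j) has_sum c (0, 0)) {(0, 0)}"
        by (rule has_sum_finiteI) auto
      then have "((\<lambda>(i, j). c (i, j) * 0 ^ i * 0 ^ j) has_sum c (0, 0)) UNIV"
        by (subst has_sum_cong_neutral[where T = "{(0, 0)}"]) auto
      then show ?thesis using F[of 0 0] t by (auto intro: has_sum_unique)
    qed
    have 1: "(?T has_sum c (0, 0)) {(0, 0)}"
      by (rule has_sum_finiteI) auto
    have 2: "(?T has_sum x * A (x, y)) (range (\<lambda>(i, j). (Suc i, j)))"
    proof (subst has_sum_reindex)
      show "((?T \<circ> (\<lambda>(i, j). (Suc i, j))) has_sum x * A (x, y)) UNIV"
        using has_sum_cmult_right[OF sA[OF xy], of x]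
        by (simp add: a_def o_def case_prod_unfold mult_ac)
    qed (auto simp: inj_on_def)
    have 3: "(?T has_sum y * B (x, y)) ((\<lambda>(i, j). (i, Suc j)) ` ({0} \<times> UNIV))"
    proof (subst has_sum_reindex)
      have "((?T \<circ> (\<lambda>(i, j). (i, Suc j))) has_sum y * B (x, y)) ({0} \<times> UNIV) \<longleftrightarrow>
        ((\<lambda>p. y * (\<lambda>(i, j). b (i, j) * x ^ i * y ^ j) p) has_sum y * B (x, y)) UNIV"
        by (rule has_sum_cong_neutral) (auto simp: b_def split: if_splits)
      then show "((?T \<circ> (\<lambda>(i, j). (i, Suc j))) has_sum y * B (x, y)) ({0} \<times> UNIV)"
        using has_sum_cmult_right[OF sB[OF xy], of y] by blast
    qed (auto simp: inj_on_def)
    have "(?T has_sum (c (0, 0) + x * A (x, y) + y * B (x, y)))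
        (({(0, 0)} \<union> range (\<lambda>(i, j). (Suc i, j))) \<union> (\<lambda>(i, j). (i, Suc j)) ` ({0} \<times> UNIV))"
      by (intro has_sum_Un_disjoint 1 2 3) auto
    also have "({(0, 0)} \<union> range (\<lambda>(i, j). (Suc i, j))) \<union> (\<lambda>(i, j). (i, Suc j)) ` ({0} \<times> UNIV) = UNIV"
    proof -
      have "(i, j) \<in> ({(0, 0)} \<union> range (\<lambda>(i, j). (Suc i, j))) \<union> (\<lambda>(i, j). (i, Suc j)) ` ({0} \<times> UNIV)" for i j
        by (cases i; cases j) (auto simp: image_iff)
      then show ?thesis by (auto simp: set_eq_iff)
    qed
    finally show ?thesis
      unfolding c00 using has_sum_unique[OF F[OF xy]] by blast
  qed
  ultimately show ?thesis using that t by blast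
qed

lemma eventually_nhds_00_iff:
  "(\<forall>\<^sub>F z in nhds ((0, 0) :: complex \<times> complex). P z) \<longleftrightarrow>
     (\<exists>r>0. \<forall>x y. norm x < r \<longrightarrow> norm y < r \<longrightarrow> P (x, y))"
proof
  assume "\<forall>\<^sub>F z in nhds ((0, 0) :: complex \<times> complex). P z"
  then obtain e where e: "e > 0" "\<And>z. dist z (0, 0) < e \<Longrightarrow> P z"
    by (auto simp: eventually_nhds_metric)
  have "P (x, y)" if "norm x < e / 2" "norm y < e / 2" for x y
    using norm_Pair_le[of x y] that by (intro e(2)) (simp add: dist_norm flip: zero_prod_def)
  then show "\<exists>r>0. \<forall>x y. norm x < r \<longrightarrow> norm y < r \<longrightarrow> P (x, y)"
    using e(1) by (intro exI[of _ "e / 2"]) auto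
next
  assume "\<exists>r>0. \<forall>x y. norm x < r \<longrightarrow> norm y < r \<longrightarrow> P (x, y)"
  then obtain r where r: "r > 0" "\<And>x y. norm x < r \<Longrightarrow> norm y < r \<Longrightarrow> P (x, y)" by blast
  have "P z" if "dist z (0, 0) < r" for z
  proof -
    have "norm (fst z) < r" "norm (snd z) < r"
      using that norm_fst_le[of "fst z" "snd z"] norm_snd_le[of "snd z" "fst z"]
      by (auto simp: dist_norm zero_prod_def[symmetric])
    then show ?thesis using r(2)[of "fst z" "snd z"] by simp
  qed
  then show "\<forall>\<^sub>F z in nhds ((0, 0) :: complex \<times> complex). P z"
    using r(1) by (auto simp: eventually_nhds_metric)
qed

lemma germ_of_eq_iff:
  "germ_of F = germ_of G \<longleftrightarrow> (\<exists>r>0. \<forall>x y. norm x < r \<longrightarrow> norm y < r \<longrightarrow> F (x, y) = G (x, y))"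
  by (simp add: germ.abs_eq_iff eventually_nhds_00_iff)

lemma germ_value_simps [simp]:
  "germ_value (g + h) = germ_value g + germ_value h"
  "germ_value (g * h) = germ_value g * germ_value h"
  "germ_value (germ_const c) = c" "germ_value 0 = 0" "germ_value 1 = 1"
  "germ_value gX = 0" "germ_value gY = 0"
  unfolding gX_def gY_def by (transfer; simp)+

lemma O2_divide:
  assumes "g \<in> carrier O2"
  obtains a b where "a \<in> carrier O2" "b \<in> carrier O2"
    "g = germ_const (germ_value g) + gX * a + gY * b"
proof -
  obtain F where F: "g = germ_of F" "holomorphic_near_0 F" using assms by (auto simp: O2_def)
  obtain A B r where AB: "holomorphic_near_0 A" "holomorphic_near_0 B" "r > 0"
    "\<And>x y. norm x < r \<Longrightarrow> norm y < r \<Longrightarrow> F (x, y) = F (0, 0) + x * A (x, y) + y * B (x, y)"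
    using F(2) by (rule holomorphic_near_0_divide) blast
  have "g = germ_const (germ_value g) + gX * germ_of A + gY * germ_of B"
    unfolding F(1) gX_def gY_def germ_const.abs_eq germ_value.abs_eq times_germ.abs_eq plus_germ.abs_eq
      germ_of_eq_iff
    by (rule exI[of _ r]) (simp only: fst_conv snd_conv AB(3) simp_thms, metis AB(4))
  then show ?thesis using that[of "germ_of A" "germ_of B"] AB by (auto simp: O2_def)
qed

text \<open>A recursive description of the powers of the maximal ideal, suited to induction on the
  exponent; \<open>max_ideal_power\<close> proves the agreement with the ideal-theoretic
  powers.\<close>

primrec max_pow :: "nat \<Rightarrow> germ set" where
  "max_pow 0 = carrier O2"
| "max_pow (Suc k) = {gX * a + gY * b |a b. a \<in> max_pow k \<and> b \<in> max_pow k}"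

lemma max_pow_add: "g \<in> max_pow k \<Longrightarrow> h \<in> max_pow k \<Longrightarrow> g + h \<in> max_pow k"
proof (induction k arbitrary: g h)
  case (Suc k)
  from Suc.prems obtain a b a' b' where ab: "g = gX * a + gY * b" "h = gX * a' + gY * b'"
    "a \<in> max_pow k" "b \<in> max_pow k" "a' \<in> max_pow k" "b' \<in> max_pow k" by auto
  then have "g + h = gX * (a + a') + gY * (b + b')" by (simp add: algebra_simps)
  then show ?case using Suc.IH ab by auto
qed (auto intro: O2_closed)

lemma max_pow_mult_left: "h \<in> carrier O2 \<Longrightarrow> g \<in> max_pow k \<Longrightarrow> h * g \<in> max_pow k"
proof (induction k arbitrary: g)
  case (Suc k)
  from Suc.prems obtain a b where ab: "g = gX * a + gY * b" "a \<in> max_pow k" "b \<in> max_pow k" by auto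
  then have "h * g = gX * (h * a) + gY * (h * b)" by (simp add: algebra_simps)
  then show ?case using Suc ab by auto
qed (auto intro: O2_closed)

lemma max_pow_0_mem: "0 \<in> max_pow k"
proof (induction k)
  case (Suc k)
  have "0 = gX * 0 + gY * 0" by simp
  with Suc show ?case unfolding max_pow.simps by blast
qed (auto intro: O2_closed)

lemma max_pow_gX: "g \<in> max_pow k \<Longrightarrow> gX * g \<in> max_pow (Suc k)"
  and max_pow_gY: "g \<in> max_pow k \<Longrightarrow> gY * g \<in> max_pow (Suc k)"
proof -
  have "gX * g = gX * g + gY * 0" "gY * g = gX * 0 + gY * g" by simp_all
  then show "g \<in> max_pow k \<Longrightarrow> gX * g \<in> max_pow (Suc k)" "g \<in> max_pow k \<Longrightarrow> gY * g \<in> max_pow (Suc k)"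
    using max_pow_0_mem[of k] unfolding max_pow.simps by blast+
qed

lemma max_pow_mono_Suc: "max_pow (Suc k) \<subseteq> max_pow k"
  by (auto intro!: max_pow_add max_pow_mult_left gX_in_O2 gY_in_O2)

lemma max_pow_mono: "k \<le> n \<Longrightarrow> max_pow n \<subseteq> max_pow k"
  using max_pow_mono_Suc by (rule lift_Suc_antimono_le)

lemma max_pow_carrier: "max_pow k \<subseteq> carrier O2"
  using max_pow_mono[of 0 k] by simp

lemma max_pow_mult: "g \<in> max_pow k \<Longrightarrow> h \<in> max_pow l \<Longrightarrow> g * h \<in> max_pow (k + l)"
proof (induction k arbitrary: g)
  case 0
  then show ?case by (simp add: max_pow_mult_left)
next
  case (Suc k)
  from Suc.prems obtain a b where ab: "g = gX * a + gY * b" "a \<in> max_pow k" "b \<in> max_pow k" by auto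
  then have "g * h = gX * (a * h) + gY * (b * h)" by (simp add: algebra_simps)
  then show ?case using Suc ab by auto
qed

lemma max_pow_monomial: "gX ^ i * gY ^ j \<in> max_pow (i + j)"
proof -
  have "gX ^ i \<in> max_pow i" for i
    by (induction i) (simp_all add: O2_1 max_pow_gX del: max_pow.simps(2))
  moreover have "gY ^ j \<in> max_pow j" for j
    by (induction j) (simp_all add: O2_1 max_pow_gY del: max_pow.simps(2))
  ultimately show ?thesis by (rule max_pow_mult)
qed

lemma ideal_O2I:
  assumes "S \<subseteq> carrier O2" "0 \<in> S" "\<And>g h. g \<in> S \<Longrightarrow> h \<in> S \<Longrightarrow> g + h \<in> S"
    and mult: "\<And>h g. h \<in> carrier O2 \<Longrightarrow> g \<in> S \<Longrightarrow> h * g \<in> S"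
  shows "ideal S O2"
proof (rule idealI[OF O2.ring_axioms])
  have neg: "- g \<in> S" if "g \<in> S" for g
    using mult[OF O2_const[of "-1"] that]
    by (metis germ.scale_minus_left germ.scale_one)
  have "\<ominus>\<^bsub>O2\<^esub> g = - g" if "g \<in> S" for g
    using that assms(1) neg[OF that]
    by (intro O2.minus_equality) auto
  then show "subgroup S (add_monoid O2)"
    by (intro O2.add.subgroupI) (use assms neg in \<open>auto simp flip: a_inv_def\<close>)
  show "x \<otimes>\<^bsub>O2\<^esub> a \<in> S" "a \<otimes>\<^bsub>O2\<^esub> x \<in> S" if "a \<in> S" "x \<in> carrier O2" for a x
    using mult[OF that(2,1)] by (simp_all add: mult.commute)
qed

lemma ideal_max_pow: "ideal (max_pow k) O2"
  by (rule ideal_O2I) (use max_pow_carrier max_pow_add max_pow_0_mem max_pow_mult_left in auto)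

lemma max_pow_subspace: "germ.subspace (max_pow k)"
  by (rule O2_ideal_subspace[OF ideal_max_pow])

text \<open>For a germ with value 0 the constant term in \<open>O2_divide\<close> disappears,
  leaving a combination of \<open>gX\<close> and \<open>gY\<close>.\<close>

lemma max_ideal_eq: "max_ideal = max_pow 1"
proof
  show "max_ideal \<subseteq> max_pow 1"
  proof
    fix g assume "g \<in> max_ideal"
    then have g: "g \<in> carrier O2" "germ_value g = 0" by (auto simp: max_ideal_def)
    obtain a b where "a \<in> carrier O2" "b \<in> carrier O2" "g = germ_const (germ_value g) + gX * a + gY * b"
      using g(1) by (rule O2_divide)
    then show "g \<in> max_pow 1" using g(2) by (auto simp: germ_const_simps)
  qed
  show "max_pow 1 \<subseteq> max_ideal"
    using max_pow_carrier[of 1] by (auto simp: max_ideal_def)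
qed

lemma max_ideal_power: "max_ideal [^]\<^bsub>ideals_set O2\<^esub> k = max_pow k"
proof (induction k)
  case 0
  then show ?case by (simp add: nat_pow_def ideals_set_def)
next
  case (Suc k)
  have "max_ideal [^]\<^bsub>ideals_set O2\<^esub> Suc k = max_pow k \<cdot>\<^bsub>O2\<^esub> max_pow 1"
    using Suc by (simp add: nat_pow_def ideals_set_def max_ideal_eq)
  also have "\<dots> = max_pow (Suc k)"
  proof
    show "max_pow k \<cdot>\<^bsub>O2\<^esub> max_pow 1 \<subseteq> max_pow (Suc k)"
    proof
      fix z assume "z \<in> max_pow k \<cdot>\<^bsub>O2\<^esub> max_pow 1"
      then show "z \<in> max_pow (Suc k)"
      proof (induction rule: ideal_prod.induct)
        case (prod i j)
        then show ?case using max_pow_mult[of i k j 1] by simp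
      next
        case (sum s1 s2)
        then show ?case by (metis O2_ops(2) max_pow_add)
      qed
    qed
    show "max_pow (Suc k) \<subseteq> max_pow k \<cdot>\<^bsub>O2\<^esub> max_pow 1"
    proof
      fix z assume "z \<in> max_pow (Suc k)"
      then obtain a b where ab: "z = a * gX + b * gY" "a \<in> max_pow k" "b \<in> max_pow k"
        by (auto simp: mult.commute)
      have "gX \<in> max_pow 1" "gY \<in> max_pow 1"
        using max_pow_monomial[of 1 0] max_pow_monomial[of 0 1] by (simp_all del: max_pow.simps)
      then show "z \<in> max_pow k \<cdot>\<^bsub>O2\<^esub> max_pow 1"
        using ideal_prod.sum[OF ideal_prod.prod[of a "max_pow k" gX "max_pow 1" O2]
            ideal_prod.prod[of b "max_pow k" gY "max_pow 1" O2]] ab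
        by (simp del: max_pow.simps)
    qed
  qed
  finally show ?case .
qed

lemma span_mult:
  assumes "a \<in> germ.span S"
  shows "h * a \<in> germ.span ((*) h ` S)"
  using assms
proof (induction rule: germ.span_induct_alt)
  case base
  then show ?case by (simp add: germ.span_zero)
next
  case (step c x y)
  have "h * (germ_const c * x + y) = germ_const c * (h * x) + h * y" by (simp add: algebra_simps)
  moreover have "h * x \<in> germ.span ((*) h ` S)" using step by (intro germ.span_base) auto
  ultimately show ?case using step by (simp add: germ.span_add germ.span_scale)
qed

section \<open>Monomials as a basis modulo powers of the maximal ideal\<close>

definition monomials :: "nat \<Rightarrow> nat \<Rightarrow> (nat \<times> nat) set" where
  "monomials k n = {(i, j). k \<le> i + j \<and> i + j < n}"

abbreviation gmon :: "nat \<times> nat \<Rightarrow> germ" where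
  "gmon p \<equiv> gX ^ fst p * gY ^ snd p"

text \<open>Degree zero is \<open>O2_divide\<close>: a germ is a constant plus an element of the
  first power. Multiplication by a coordinate raises the degree of the monomials and the exponent of
  the remainder together, which gives the induction step.\<close>

lemma max_pow_span_Suc: "max_pow k \<subseteq> germ.span (gmon ` monomials k (Suc k) \<union> max_pow (Suc k))"
proof (induction k)
  case 0
  show ?case
  proof
    fix g assume "g \<in> max_pow 0"
    then obtain a b where "a \<in> carrier O2" "b \<in> carrier O2" "g = germ_const (germ_value g) * 1 + (gX * a + gY * b)"
      by (auto elim: O2_divide simp: add.assoc)
    moreover have "1 \<in> gmon ` monomials 0 (Suc 0)"
      by (auto simp: monomials_def image_iff)
    ultimately show "g \<in> germ.span (gmon ` monomials 0 (Suc 0) \<union> max_pow (Suc 0))"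
      by (metis (no_types, lifting) UnI1 UnI2 germ.span_add germ.span_base germ.span_scale max_pow.simps(1)
          max_pow_add max_pow_gX max_pow_gY)
  qed
next
  case (Suc k)
  have "gX * a \<in> germ.span (gmon ` monomials (Suc k) (Suc (Suc k)) \<union> max_pow (Suc (Suc k)))"
    "gY * a \<in> germ.span (gmon ` monomials (Suc k) (Suc (Suc k)) \<union> max_pow (Suc (Suc k)))"
    if "a \<in> max_pow k" for a
  proof -
    have a: "a \<in> germ.span (gmon ` monomials k (Suc k) \<union> max_pow (Suc k))"
      using Suc that by auto
    have "gX * gmon p \<in> gmon ` monomials (Suc k) (Suc (Suc k))"
      "gY * gmon p \<in> gmon ` monomials (Suc k) (Suc (Suc k))" if "p \<in> monomials k (Suc k)" for p
    proof -
      have "gX * gmon p = gmon (Suc (fst p), snd p)" "gY * gmon p = gmon (fst p, Suc (snd p))"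
        by (simp_all add: mult_ac)
      moreover have "(Suc (fst p), snd p) \<in> monomials (Suc k) (Suc (Suc k))"
        "(fst p, Suc (snd p)) \<in> monomials (Suc k) (Suc (Suc k))"
        using that by (auto simp: monomials_def)
      ultimately show "gX * gmon p \<in> gmon ` monomials (Suc k) (Suc (Suc k))"
        "gY * gmon p \<in> gmon ` monomials (Suc k) (Suc (Suc k))"
        using image_eqI by blast+
    qed
    then have "(*) gX ` (gmon ` monomials k (Suc k) \<union> max_pow (Suc k))
        \<subseteq> gmon ` monomials (Suc k) (Suc (Suc k)) \<union> max_pow (Suc (Suc k))"
      "(*) gY ` (gmon ` monomials k (Suc k) \<union> max_pow (Suc k))
        \<subseteq> gmon ` monomials (Suc k) (Suc (Suc k)) \<union> max_pow (Suc (Suc k))"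
      using max_pow_gX[of _ "Suc k"] max_pow_gY[of _ "Suc k"]
      unfolding image_Un image_image by (intro Un_mono image_subsetI; simp del: max_pow.simps)+
    then show "gX * a \<in> germ.span (gmon ` monomials (Suc k) (Suc (Suc k)) \<union> max_pow (Suc (Suc k)))"
      "gY * a \<in> germ.span (gmon ` monomials (Suc k) (Suc (Suc k)) \<union> max_pow (Suc (Suc k)))"
      by (blast intro: subsetD[OF germ.span_mono span_mult[OF a]])+
  qed
  then show ?case
    by (auto intro!: germ.span_add simp del: max_pow.simps(2) simp add: max_pow.simps(2)[of k])
qed

lemma max_pow_span: "k \<le> n \<Longrightarrow> max_pow k \<subseteq> germ.span (gmon ` monomials k n \<union> max_pow n)"
proof (induction n rule: dec_induct)
  case base
  show ?case by (auto intro: germ.span_base)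
next
  case (step n)
  have "max_pow n \<subseteq> germ.span (gmon ` monomials k (Suc n) \<union> max_pow (Suc n))"
    using max_pow_span_Suc[of n] step(1)
    by (rule_tac order_trans[OF _ germ.span_mono]) (auto simp: monomials_def)
  moreover have "gmon ` monomials k n \<subseteq> germ.span (gmon ` monomials k (Suc n) \<union> max_pow (Suc n))"
    by (auto simp: monomials_def intro!: germ.span_base)
  ultimately show ?case
    using order_trans[OF step.IH germ.span_minimal[OF Un_least germ.subspace_span]] by blast
qed

text \<open>The growth estimate replaces the uniqueness of power series coefficients in the proof that
  monomials of degree less than \<open>n\<close> are independent modulo \<open>max_pow n\<close>.\<close>

lemma max_pow_growth:
  assumes "g \<in> max_pow k"
  obtains F C r where "g = germ_of F" "C > 0" "r > 0"
    "\<And>x y. norm x < r \<Longrightarrow> norm y < r \<Longrightarrow> norm (F (x, y)) \<le> C * max (norm x) (norm y) ^ k"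
proof -
  have "\<exists>F C r. g = germ_of F \<and> C > 0 \<and> r > 0 \<and>
    (\<forall>x y. norm x < r \<longrightarrow> norm y < r \<longrightarrow> norm (F (x, y)) \<le> C * max (norm x) (norm y) ^ k)"
    using assms
  proof (induction k arbitrary: g)
    case 0
    then obtain F where F: "g = germ_of F" "holomorphic_near_0 F" by (auto simp: O2_def)
    obtain C r where "C > 0" "r > 0" "\<And>x y. norm x < r \<Longrightarrow> norm y < r \<Longrightarrow> norm (F (x, y)) \<le> C"
      using F(2) by (rule holomorphic_near_0_bounded) blast
    then show ?case using F by (intro exI[of _ F] exI[of _ C] exI[of _ r]) auto
  next
    case (Suc k)
    obtain a b where ab: "g = gX * a + gY * b" "a \<in> max_pow k" "b \<in> max_pow k" using Suc.prems by auto
    obtain A C r where A: "a = germ_of A" "C > 0" "r > 0"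
      "\<And>x y. norm x < r \<Longrightarrow> norm y < r \<Longrightarrow> norm (A (x, y)) \<le> C * max (norm x) (norm y) ^ k"
      using Suc.IH[OF ab(2)] by blast
    obtain B D s where B: "b = germ_of B" "D > 0" "s > 0"
      "\<And>x y. norm x < s \<Longrightarrow> norm y < s \<Longrightarrow> norm (B (x, y)) \<le> D * max (norm x) (norm y) ^ k"
      using Suc.IH[OF ab(3)] by blast
    have "g = germ_of (\<lambda>z. fst z * A z + snd z * B z)"
      by (simp add: ab A(1) B(1) gX_def gY_def times_germ.abs_eq plus_germ.abs_eq)
    moreover have "norm (x * A (x, y) + y * B (x, y)) \<le> (C + D) * max (norm x) (norm y) ^ Suc k"
      if "norm x < min r s" "norm y < min r s" for x y
    proof -
      let ?m = "max (norm x) (norm y)"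
      have "norm (x * A (x, y) + y * B (x, y)) \<le> norm x * norm (A (x, y)) + norm y * norm (B (x, y))"
        by (metis norm_mult norm_triangle_ineq)
      also have "\<dots> \<le> ?m * (C * ?m ^ k) + ?m * (D * ?m ^ k)"
        using A(4) B(4) that by (intro add_mono mult_mono) (auto simp: le_max_iff_disj)
      finally show ?thesis by (simp add: algebra_simps)
    qed
    ultimately show ?case
      using A B by (intro exI[of _ "\<lambda>z. fst z * A z + snd z * B z"] exI[of _ "C + D"] exI[of _ "min r s"]) auto
  qed
  then show ?thesis using that by blast
qed

text \<open>For positive exponent the bound forces a zero at the origin; dividing by
  \<open>t\<close> then lowers the degree bound and the exponent together.\<close>

lemma poly_eq_0_if_small:
  fixes p :: "complex poly"
  assumes "\<forall>i\<ge>k. Polynomial.coeff p i = 0"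
    and "\<forall>\<^sub>F t in at 0. norm (poly p t) \<le> C * norm t ^ k"
  shows "p = 0"
  using assms
proof (induction k arbitrary: p)
  case 0
  then show ?case by (simp add: poly_eq_iff)
next
  case (Suc k)
  have "((\<lambda>t. C * norm t ^ Suc k) \<longlongrightarrow> C * norm (0::complex) ^ Suc k) (at (0::complex))"
    by (intro tendsto_intros)
  then have "((\<lambda>t. C * norm t ^ Suc k) \<longlongrightarrow> 0) (at (0::complex))" by simp
  with Suc.prems(2) have "(poly p \<longlongrightarrow> 0) (at 0)" by (rule Lim_null_comparison)
  moreover have "(poly p \<longlongrightarrow> poly p 0) (at 0)"
    using poly_isCont[of 0 p] by (simp add: isCont_def)
  ultimately have "poly p 0 = 0"
    using tendsto_unique[OF trivial_limit_at] by blast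
  then obtain q where q: "p = pCons 0 q"
    by (metis poly_0_coeff_0 pCons_cases coeff_pCons_0)
  have "\<forall>\<^sub>F t in at 0. norm (poly q t) \<le> C * norm t ^ k"
    using Suc.prems(2) eventually_neq_at_within[of 0]
  proof eventually_elim
    case (elim t)
    then have "norm t * norm (poly q t) \<le> norm t * (C * norm t ^ k)"
      by (simp add: q norm_mult algebra_simps)
    then show ?case using elim by simp
  qed
  moreover have "\<forall>i\<ge>k. Polynomial.coeff q i = 0"
    using Suc.prems(1) q by (metis Suc_le_mono coeff_pCons_Suc)
  ultimately have "q = 0" by (rule Suc.IH[rotated])
  then show ?case using q by simp
qed

lemma germ_of_sum: "germ_of (\<lambda>z. \<Sum>a\<in>A. F a z) = (\<Sum>a\<in>A. germ_of (F a))"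
  by (induction A rule: infinite_finite_induct) (simp_all add: plus_germ.abs_eq[symmetric] zero_germ_def)

lemma gmon_eq: "gmon p = germ_of (\<lambda>z. fst z ^ fst p * snd z ^ snd p)"
proof -
  have "germ_of F ^ n = germ_of (\<lambda>z. F z ^ n)" for F n
    by (induction n) (simp_all add: one_germ_def times_germ.abs_eq)
  then show ?thesis by (simp add: gX_def gY_def times_germ.abs_eq)
qed

text \<open>Restriction to the lines \<open>y = l x\<close> separates the homogeneous components,
  each of which vanishes for every slope \<open>l\<close>. As a function of the slope, a component
  is a polynomial with coefficients \<open>c p\<close>, because within a fixed degree the exponent
  of \<open>y\<close> determines the monomial.\<close>

lemma monomials_independent_mod:
  assumes "finite T" "T \<subseteq> monomials 0 n" "(\<Sum>p\<in>T. germ_const (c p) * gmon p) \<in> max_pow n"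
  shows "\<forall>p\<in>T. c p = 0"
proof -
  obtain F C r where F: "(\<Sum>p\<in>T. germ_const (c p) * gmon p) = germ_of F" "C > 0" "r > 0"
    "\<And>x y. norm x < r \<Longrightarrow> norm y < r \<Longrightarrow> norm (F (x, y)) \<le> C * max (norm x) (norm y) ^ n"
    using assms(3) by (rule max_pow_growth) blast
  have "germ_of F = germ_of (\<lambda>z. \<Sum>p\<in>T. c p * (fst z ^ fst p * snd z ^ snd p))"
    unfolding F(1)[symmetric] germ_of_sum gmon_eq germ_const.abs_eq times_germ.abs_eq ..
  then obtain s where s: "s > 0"
    "\<And>x y. norm x < s \<Longrightarrow> norm y < s \<Longrightarrow> F (x, y) = (\<Sum>p\<in>T. c p * (x ^ fst p * y ^ snd p))"
    by (auto simp: germ_of_eq_iff)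
  \<comment> \<open>On the line \<open>y = l x\<close> the combination is a polynomial of degree less than \<open>n\<close> that is \<open>O(t\<^sup>n)\<close>.\<close>
  have line: "(\<Sum>p\<in>{p\<in>T. fst p + snd p = d}. c p * l ^ snd p) = 0" for l d
  proof -
    define P where "P = (\<Sum>p\<in>T. Polynomial.monom (c p * l ^ snd p) (fst p + snd p))"
    \<comment> \<open>With this factor, \<open>norm t * L\<close> bounds both coordinates of the
      point \<open>(t, l * t)\<close>.\<close>
    define L where "L = norm l + 1"
    have L: "L > 0" by (simp add: L_def add_nonneg_pos)
    have P: "poly P t = (\<Sum>p\<in>T. c p * (t ^ fst p * (l * t) ^ snd p))" for t
      by (simp add: P_def poly_sum poly_monom power_add power_mult_distrib mult_ac)
    have "norm (poly P t) \<le> (C * L ^ n) * norm t ^ n" if t: "norm t < min r s / L" for t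
    proof -
      have "norm t * L < min r s" using t L by (simp add: field_simps)
      moreover have lt: "norm t \<le> norm t * L" "norm (l * t) \<le> norm t * L"
        by (auto simp: L_def norm_mult algebra_simps)
      ultimately have b: "norm t < r" "norm t < s" "norm (l * t) < r" "norm (l * t) < s" by linarith+
      have "norm (poly P t) = norm (F (t, l * t))" using s(2)[OF b(2,4)] P by simp
      also have "\<dots> \<le> C * max (norm t) (norm (l * t)) ^ n" by (rule F(4)[OF b(1,3)])
      also have "\<dots> \<le> C * (norm t * L) ^ n"
        using lt F(2) by (intro mult_left_mono power_mono) (auto simp: le_max_iff_disj)
      finally show ?thesis by (simp add: power_mult_distrib mult_ac)
    qed
    then have "\<forall>\<^sub>F t in at 0. norm (poly P t) \<le> (C * L ^ n) * norm t ^ n"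
      using F(3) s(1) L by (auto simp: eventually_at intro!: exI[of _ "min r s / L"])
    moreover have "\<forall>i\<ge>n. Polynomial.coeff P i = 0"
      using assms(2) by (auto simp: P_def coeff_sum monomials_def intro!: sum.neutral)
    ultimately have "P = 0" by (rule poly_eq_0_if_small[rotated])
    then have "Polynomial.coeff P d = 0" by simp
    then show ?thesis
      using assms(1) by (simp add: P_def coeff_sum sum.inter_filter if_distrib cong: if_cong)
  qed
  show ?thesis
  proof
    fix p assume p: "p \<in> T"
    let ?T = "{q\<in>T. fst q + snd q = fst p + snd p}"
    define P where "P = (\<Sum>q\<in>?T. Polynomial.monom (c q) (snd q))"
    have "poly P l = 0" for l
      using line[where d = "fst p + snd p" and l = l] by (simp add: P_def poly_sum poly_monom)
    then have "P = 0" using poly_all_0_iff_0 by blast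
    then have "0 = Polynomial.coeff P (snd p)" by simp
    also have "\<dots> = (\<Sum>q\<in>?T. if q = p then c q else 0)"
      unfolding P_def coeff_sum by (rule sum.cong) (auto simp: prod_eq_iff)
    also have "\<dots> = c p" using assms(1) p by simp
    finally show "c p = 0" by simp
  qed
qed

lemma card_monomials: "finite (monomials k n)" "card (monomials 0 n) = n * (n + 1) div 2"
  "k \<le> n \<Longrightarrow> card (monomials k n) = n * (n + 1) div 2 - k * (k + 1) div 2"
proof -
  have fin: "finite (monomials k n)" for k n
    by (rule finite_subset[of _ "{..n} \<times> {..n}"]) (auto simp: monomials_def)
  show "finite (monomials k n)" by (rule fin)
  have c0: "card (monomials 0 n) = n * (n + 1) div 2" for n
  proof -
    have "monomials 0 n = (\<Union>i\<in>{..<n}. Pair i ` {..<n - i})"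
      by (auto simp: monomials_def image_iff)
    also have "card \<dots> = (\<Sum>i<n. card (Pair i ` {..<n - i}))"
      by (intro card_UN_disjoint) auto
    also have "\<dots> = (\<Sum>i<n. n - i)"
      by (intro sum.cong) (auto simp: card_image inj_on_def)
    also have "\<dots> = \<Sum>{1..n}"
      by (rule sum.reindex_bij_witness[of _ "\<lambda>i. n - i" "\<lambda>i. n - i"]) auto
    also have "\<dots> = n * (n + 1) div 2" using Sum_Icc_nat[of 1 n] by (simp add: mult.commute)
    finally show ?thesis .
  qed
  show "card (monomials 0 n) = n * (n + 1) div 2" by (rule c0)
  show "card (monomials k n) = n * (n + 1) div 2 - k * (k + 1) div 2" if "k \<le> n"
  proof -
    have "monomials k n = monomials 0 n - monomials 0 k" "monomials 0 k \<subseteq> monomials 0 n"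
      using that by (auto simp: monomials_def)
    then show ?thesis
      using card_Diff_subset[OF fin, of 0 k "monomials 0 n"] c0 by simp
  qed
qed

section \<open>Weighted homogenization\<close>

definition weighted_set :: "nat \<Rightarrow> nat \<Rightarrow> nat \<Rightarrow> (nat \<times> nat) set" where
  "weighted_set a b e = {(i, j). a * i + b * j = e}"

lemma finite_weighted_set: "a > 0 \<Longrightarrow> b > 0 \<Longrightarrow> finite (weighted_set a b e)"
proof (rule finite_subset)
  assume "a > 0" "b > 0"
  then have "i \<le> a * i + b * j" "j \<le> a * i + b * j" for i j
    by (simp_all add: trans_le_add1 trans_le_add2)
  then show "weighted_set a b e \<subseteq> {..e} \<times> {..e}" by (auto simp: weighted_set_def)
qed simp

text \<open>Terms of \<open>p\<close> in an exponent \<open>j\<close> for which \<open>e - b j\<close> is not a nonnegative multiple of \<open>a\<close> are dropped.\<close>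

definition homogenize :: "nat \<Rightarrow> nat \<Rightarrow> nat \<Rightarrow> complex poly \<Rightarrow> germ \<Rightarrow> germ \<Rightarrow> germ" where
  "homogenize a b e p X Y =
     (\<Sum>(i, j)\<in>weighted_set a b e. germ_const (Polynomial.coeff p j) * (X ^ i * Y ^ j))"

lemma homogenize_add:
  "homogenize a b e (p + q) X Y = homogenize a b e p X Y + homogenize a b e q X Y"
  by (simp add: homogenize_def case_prod_unfold germ_const_simps distrib_right sum.distrib)

lemma germ_const_sum: "germ_const (\<Sum>a\<in>A. f a) = (\<Sum>a\<in>A. germ_const (f a))"
  by (induction A rule: infinite_finite_induct) (simp_all add: germ_const_simps)

text \<open>The asymmetric conditions allow \<open>p\<close> to be an arbitrary Bezout cofactor
  while \<open>q\<close> is a dehomogenized form. A nonzero product term of weight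
  \<open>e + e'\<close> uses a term of \<open>q\<close> of weight \<open>e'\<close>, which leaves
  weight \<open>e\<close> for \<open>p\<close>; the degree bound keeps the remaining exponent of
  \<open>X\<close> nonnegative. Hence the terms of \<open>p\<close> dropped by
  \<open>homogenize\<close> contribute nothing to the product either.\<close>

lemma homogenize_mult:
  assumes a: "a > 0" and b: "b > 0" and p: "b * degree p \<le> e"
    and q: "\<And>j. Polynomial.coeff q j \<noteq> 0 \<Longrightarrow> \<exists>i. (i, j) \<in> weighted_set a b e'"
  shows "homogenize a b (e + e') (p * q) X Y = homogenize a b e p X Y * homogenize a b e' q X Y"
proof -
  let ?W = "weighted_set a b"
  let ?S = "Sigma (?W (e + e')) (\<lambda>(m, n). {..n})"
  let ?T = "?W e \<times> ?W e'"
  let ?c = "\<lambda>j l. Polynomial.coeff p j * Polynomial.coeff q l"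
  have fin: "finite ?S" "finite ?T"
    by (auto intro!: finite_SigmaI finite_weighted_set a b simp: case_prod_unfold)
  have key: "\<exists>i i'. (e - b * j) div a = i \<and> (e' - b * (n - j)) div a = i' \<and> m = i + i' \<and>
      a * i + b * j = e \<and> a * i' + b * (n - j) = e'"
    if S: "((m, n), j) \<in> ?S" and c: "?c j (n - j) \<noteq> 0" for m n j
  proof -
    obtain i' where i': "a * i' + b * (n - j) = e'"
      using q[of "n - j"] c by (auto simp: weighted_set_def)
    have n: "a * m + b * n = e + e'" "j \<le> n" using S by (auto simp: weighted_set_def)
    then have "b * n = b * (n - j) + b * j" by (metis le_add_diff_inverse2 add_mult_distrib2)
    then have m: "a * m + b * j = e + a * i'" using n i' by linarith
    have "j \<le> degree p" using c by (auto intro: le_degree)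
    then have bj: "b * j \<le> e" using p by (meson mult_le_mono2 order_trans)
    then have "a * i' \<le> a * m" using m by linarith
    then have "i' \<le> m" using a by simp
    then obtain i where i: "m = i + i'" by (metis le_add_diff_inverse2)
    then have i2: "a * i + b * j = e" using m by (simp add: algebra_simps)
    have "(e - b * j) div a = i" "(e' - b * (n - j)) div a = i'"
      using i2 i' a by (simp_all flip: i2 i')
    then show ?thesis using i i2 i' by blast
  qed
  have "homogenize a b (e + e') (p * q) X Y =
      (\<Sum>((m, n), j)\<in>?S. germ_const (?c j (n - j)) * (X ^ m * Y ^ n))"
    unfolding homogenize_def coeff_mult germ_const_sum sum_distrib_right case_prod_unfold
    by (subst sum.Sigma) (auto intro!: finite_weighted_set a b simp: case_prod_unfold)
  also have "\<dots> = (\<Sum>((i, j), (i', l))\<in>?T. germ_const (?c j l) * (X ^ (i + i') * Y ^ (j + l)))"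
  \<comment> \<open>\<open>S'\<close> and \<open>T'\<close> collect the summands with zero
    coefficient, where the exponents recovered by division need not match.\<close>
  proof (rule sum.reindex_bij_witness_not_neutral[where
        S' = "{((m, n), j) \<in> ?S. ?c j (n - j) = 0}" and T' = "{((i, j), (i', l)) \<in> ?T. ?c j l = 0}" and
        j = "\<lambda>((m, n), j). (((e - b * j) div a, j), ((e' - b * (n - j)) div a, n - j))" and
        i = "\<lambda>((i, j), (i', l)). ((i + i', j + l), j)"], goal_cases)
    case 1
    show ?case by (rule finite_subset[OF _ fin(1)]) auto
  next
    case 2
    show ?case by (rule finite_subset[OF _ fin(2)]) auto
  next
    case (3 x)
    then show ?case using key[of "fst (fst x)" "snd (fst x)" "snd x"] by (auto simp: case_prod_unfold prod_eq_iff)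
  next
    case (4 x)
    then show ?case using key[of "fst (fst x)" "snd (fst x)" "snd x"]
      by (auto simp: case_prod_unfold weighted_set_def)
  next
    case (5 x)
    then show ?case using a by (auto simp: weighted_set_def)
  next
    case (6 x)
    then show ?case by (auto simp: weighted_set_def algebra_simps)
  next
    case (7 x)
    then show ?case by (auto simp: germ_const_simps)
  next
    case (8 x)
    then show ?case by (auto simp: germ_const_simps)
  next
    case (9 x)
    then show ?case
      using key[of "fst (fst x)" "snd (fst x)" "snd x"]
      by (cases "?c (snd x) (snd (fst x) - snd x) = 0") (auto simp: case_prod_unfold germ_const_simps)
  qed
  also have "\<dots> = homogenize a b e p X Y * homogenize a b e' q X Y"
    unfolding homogenize_def sum_product
    by (subst sum.cartesian_product, rule sum.cong)
       (auto simp: germ_const_simps power_add mult_ac)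
  finally show ?thesis .
qed

text \<open>The gcd has no root, hence is a nonzero constant by the fundamental theorem of algebra;
  it remains to rescale the Bezout coefficients.\<close>

lemma bezout_if_no_common_root:
  fixes p q :: "complex poly"
  assumes "\<And>x. \<not> (poly p x = 0 \<and> poly q x = 0)"
  obtains A B where "A * p + B * q = 1"
proof -
  let ?g = "gcd p q"
  have "?g \<noteq> 0" using assms[of 0] by auto
  have "\<not> (\<exists>x. poly ?g x = 0)"
    using assms by (metis gcd_dvd1 gcd_dvd2 dvd_trans poly_eq_0_iff_dvd)
  then have "constant (poly ?g)"
    using fundamental_theorem_of_algebra by blast
  then have "degree ?g = 0" by (simp add: constant_degree)
  then obtain c where c: "?g = [:c:]" by (rule degree_eq_zeroE)
  then have "c \<noteq> 0" using \<open>?g \<noteq> 0\<close> by auto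
  have "fst (bezout_coefficients p q) * p + snd (bezout_coefficients p q) * q = [:c:]"
    using bezout_coefficients_fst_snd[of p q] c by simp
  then have "Polynomial.smult (inverse c) (fst (bezout_coefficients p q) * p + snd (bezout_coefficients p q) * q) = Polynomial.smult (inverse c) [:c:]"
    by simp
  then have "Polynomial.smult (inverse c) (fst (bezout_coefficients p q)) * p + Polynomial.smult (inverse c) (snd (bezout_coefficients p q)) * q = 1"
    using \<open>c \<noteq> 0\<close> by (simp add: smult_add_right one_pCons)
  then show ?thesis by (rule that)
qed

lemma homogenize_in_O2:
  "X \<in> carrier O2 \<Longrightarrow> Y \<in> carrier O2 \<Longrightarrow> homogenize a b e p X Y \<in> carrier O2"
  unfolding homogenize_def by (auto intro!: O2_closed)

text \<open>Homogenizing a Bezout identity \<open>A * p + B * q = 1\<close> to weight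
  \<open>a * N\<close> turns the right-hand side into \<open>X ^ N\<close> and the left-hand side
  into a combination of the homogenized \<open>p\<close> and \<open>q\<close>.\<close>

lemma homogenize_nullstellensatz:
  assumes a: "a > 0" and b: "b > 0" and X: "X \<in> carrier O2" and Y: "Y \<in> carrier O2"
    and p: "\<And>j. Polynomial.coeff p j \<noteq> 0 \<Longrightarrow> \<exists>i. (i, j) \<in> weighted_set a b e"
    and q: "\<And>j. Polynomial.coeff q j \<noteq> 0 \<Longrightarrow> \<exists>i. (i, j) \<in> weighted_set a b e'"
    and root: "\<And>x. \<not> (poly p x = 0 \<and> poly q x = 0)"
  obtains N u v where "u \<in> carrier O2" "v \<in> carrier O2"
    "X ^ N = u * homogenize a b e p X Y + v * homogenize a b e' q X Y"
proof -
  obtain A B where AB: "A * p + B * q = 1"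
    using root by (rule bezout_if_no_common_root) blast
  \<comment> \<open>\<open>N\<close> is chosen so large that the cofactor weights
    \<open>s = a * N - e\<close> and \<open>t = a * N - e'\<close> are not truncated and meet the
    degree condition of \<open>homogenize_mult\<close>.\<close>
  define D where "D = b * degree A + b * degree B"
  define N where "N = e + e' + D"
  have "N \<le> a * N" using a by simp
  then have N: "e + e' + b * degree A + b * degree B \<le> a * N" by (simp only: N_def D_def add.assoc)
  define s where "s = a * N - e"
  define t where "t = a * N - e'"
  have st: "s + e = a * N" "t + e' = a * N" "b * degree A \<le> s" "b * degree B \<le> t"
    using N unfolding s_def t_def by linarith+
  have "homogenize a b (a * N) (A * p) X Y = homogenize a b s A X Y * homogenize a b e p X Y"
    using homogenize_mult[OF a b st(3) p, where X = X and Y = Y] st(1) by simp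
  moreover have "homogenize a b (a * N) (B * q) X Y = homogenize a b t B X Y * homogenize a b e' q X Y"
    using homogenize_mult[OF a b st(4) q, where X = X and Y = Y] st(2) by simp
  moreover have "homogenize a b (a * N) 1 X Y = X ^ N"
  proof -
    have "homogenize a b (a * N) 1 X Y = (\<Sum>(i, j)\<in>{(N, 0)}. germ_const (Polynomial.coeff 1 j) * (X ^ i * Y ^ j))"
      unfolding homogenize_def using a
      by (intro sum.mono_neutral_right finite_weighted_set a b)
         (auto simp: weighted_set_def germ_const_simps split: if_splits)
    then show ?thesis by (simp add: germ_const_simps)
  qed
  ultimately have "X ^ N = homogenize a b s A X Y * homogenize a b e p X Y + homogenize a b t B X Y * homogenize a b e' q X Y"
    using AB by (metis homogenize_add)
  then show ?thesis using that homogenize_in_O2[OF X Y] by blast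
qed

section \<open>Weighted homogeneous polynomials\<close>

definition poly2_dx :: "complex poly poly \<Rightarrow> complex poly poly" where
  "poly2_dx f = map_poly pderiv f"

lemma eval2_simps [simp]:
  "eval2 0 z = 0"
  "eval2 (pCons c f) z = poly c (fst z) + snd z * eval2 f z"
  "eval2 (f + g) z = eval2 f z + eval2 g z"
  "eval2 (Polynomial.smult c f) z = poly c (fst z) * eval2 f z"
  by (simp_all add: eval2_def case_prod_unfold)

lemma eval2_dx: "((\<lambda>t. eval2 f (t, y)) has_field_derivative eval2 (poly2_dx f) (x, y)) (at x)"
proof (induction f)
  case 0
  then show ?case by (simp add: poly2_dx_def)
next
  case (pCons c f)
  have "poly2_dx (pCons c f) = pCons (pderiv c) (poly2_dx f)"
    by (simp add: poly2_dx_def map_poly_pCons)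
  then show ?case
    using pCons.IH by (auto intro!: derivative_eq_intros)
qed

lemma eval2_dy: "((\<lambda>t. eval2 f (x, t)) has_field_derivative eval2 (pderiv f) (x, y)) (at y)"
proof (induction f)
  case (pCons c f)
  then show ?case
    by (auto intro!: derivative_eq_intros simp: pderiv_pCons)
qed simp

lemma dx_eval2: "dx (eval2 f) = eval2 (poly2_dx f)"
  by (auto simp: dx_def intro!: DERIV_imp_deriv eval2_dx)

lemma dy_eval2: "dy (eval2 f) = eval2 (pderiv f)"
  by (auto simp: dy_def intro!: DERIV_imp_deriv eval2_dy)

lemma coeff2_poly2_dx: "coeff2 (poly2_dx f) i j = of_nat (Suc i) * coeff2 f (Suc i) j"
  by (simp add: coeff2_def poly2_dx_def coeff_map_poly coeff_pderiv)

lemma coeff2_pderiv: "coeff2 (pderiv f) i j = of_nat (Suc j) * coeff2 f i (Suc j)"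
  by (simp add: coeff2_def coeff_pderiv of_nat_poly algebra_simps)

text \<open>The operator \<open>a x f_x + b y f_y\<close> multiplies the coefficient of
  \<open>x^i y^j\<close> by \<open>a i + b j\<close>, which is \<open>d\<close> wherever that
  coefficient is nonzero. The identity is checked on coefficients and then evaluated.\<close>

lemma eval2_euler:
  assumes d: "d > 0" and hom: "\<And>i j. coeff2 f i j \<noteq> 0 \<Longrightarrow> a * i + b * j = d"
  shows "eval2 f z = of_nat a / of_nat d * fst z * eval2 (poly2_dx f) z +
                     of_nat b / of_nat d * snd z * eval2 (pderiv f) z"
proof -
  have "f = Polynomial.smult [:of_nat a / of_nat d:] (Polynomial.smult [:0, 1:] (poly2_dx f)) +
      Polynomial.smult [:of_nat b / of_nat d:] (pCons 0 (pderiv f))" (is "f = ?g")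
  proof (intro poly_eqI)
    fix j i
    have "coeff2 ?g i j = of_nat (a * i + b * j) / of_nat d * coeff2 f i j"
      by (cases i; cases j)
         (simp_all add: coeff2_def poly2_dx_def coeff_map_poly coeff_pderiv of_nat_poly add_divide_distrib algebra_simps)
    also have "\<dots> = coeff2 f i j" using hom[of i j] d by (cases "coeff2 f i j = 0") auto
    finally show "Polynomial.coeff (Polynomial.coeff f j) i = Polynomial.coeff (Polynomial.coeff ?g j) i"
      by (simp add: coeff2_def)
  qed
  then have "eval2 f z = eval2 ?g z" by simp
  also have "\<dots> = of_nat a / of_nat d * fst z * eval2 (poly2_dx f) z +
                     of_nat b / of_nat d * snd z * eval2 (pderiv f) z"
    by (simp add: mult_ac)
  finally show ?thesis .
qed

text \<open>The freedom in \<open>S\<close> serves two uses: the support itself, for orders of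
  vanishing, and a full weighted line, for homogenization and scaling.\<close>

lemma eval2_eq_sum:
  assumes "finite S" "\<And>i j. coeff2 f i j \<noteq> 0 \<Longrightarrow> (i, j) \<in> S"
  shows "eval2 f z = (\<Sum>(i, j)\<in>S. coeff2 f i j * (fst z ^ i * snd z ^ j))"
proof -
  define D where "D = Max ((\<lambda>j. degree (Polynomial.coeff f j)) ` {..degree f})"
  have D: "Polynomial.coeff (Polynomial.coeff f j) i = 0" if "i > D" for i j
  proof (cases "j \<le> degree f")
    case True
    then have "degree (Polynomial.coeff f j) \<le> D" by (auto simp: D_def)
    then show ?thesis using that by (intro coeff_eq_0) auto
  qed (simp add: coeff_eq_0)
  have "eval2 f z = (\<Sum>j\<le>degree f. poly (Polynomial.coeff f j) (fst z) * snd z ^ j)"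
    by (simp add: eval2_def case_prod_unfold poly_altdef[of f] poly_sum)
  also have "\<dots> = (\<Sum>j\<le>degree f. \<Sum>i\<le>D. coeff2 f i j * (fst z ^ i * snd z ^ j))"
  proof (rule sum.cong)
    fix j
    have "poly (Polynomial.coeff f j) (fst z) = (\<Sum>i\<le>D. Polynomial.coeff (Polynomial.coeff f j) i * fst z ^ i)"
      unfolding poly_altdef using D
      by (intro sum.mono_neutral_cong) (auto simp: coeff_eq_0 not_le)
    then show "poly (Polynomial.coeff f j) (fst z) * snd z ^ j = (\<Sum>i\<le>D. coeff2 f i j * (fst z ^ i * snd z ^ j))"
      by (simp add: coeff2_def sum_distrib_right mult.assoc)
  qed simp
  also have "\<dots> = (\<Sum>(j, i)\<in>{..degree f} \<times> {..D}. coeff2 f i j * (fst z ^ i * snd z ^ j))"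
    by (rule sum.cartesian_product)
  also have "\<dots> = (\<Sum>(i, j)\<in>{..D} \<times> {..degree f}. coeff2 f i j * (fst z ^ i * snd z ^ j))"
    by (rule sum.reindex_bij_witness[of _ prod.swap prod.swap]) auto
  also have "\<dots> = (\<Sum>(i, j)\<in>{p \<in> S. coeff2 f (fst p) (snd p) \<noteq> 0}. coeff2 f i j * (fst z ^ i * snd z ^ j))"
  proof (rule sum.mono_neutral_right)
    show "{p \<in> S. coeff2 f (fst p) (snd p) \<noteq> 0} \<subseteq> {..D} \<times> {..degree f}"
      using D by (auto simp: coeff2_def intro: leI) (metis coeff_0 le_degree)
  qed (use assms(2) in auto)
  also have "\<dots> = (\<Sum>(i, j)\<in>S. coeff2 f i j * (fst z ^ i * snd z ^ j))"
    using assms(1) by (intro sum.mono_neutral_left) auto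
  finally show ?thesis .
qed

lemma germ_eval2_eq_sum:
  assumes "finite S" "\<And>i j. coeff2 f i j \<noteq> 0 \<Longrightarrow> (i, j) \<in> S"
  shows "germ_of (eval2 f) = (\<Sum>(i, j)\<in>S. germ_const (coeff2 f i j) * (gX ^ i * gY ^ j))"
proof -
  have "eval2 f = (\<lambda>z. \<Sum>p\<in>S. coeff2 f (fst p) (snd p) * (fst z ^ fst p * snd z ^ snd p))"
    using eval2_eq_sum[OF assms] by (auto simp: case_prod_unfold)
  then show ?thesis
    by (simp add: germ_of_sum gmon_eq germ_const.abs_eq times_germ.abs_eq case_prod_unfold)
qed

lemma finite_coeff2_support: "finite {(i, j). coeff2 f i j \<noteq> 0}"
proof -
  have "{(i, j). coeff2 f i j \<noteq> 0} \<subseteq> (\<Union>j\<le>degree f. (\<lambda>i. (i, j)) ` {..degree (Polynomial.coeff f j)})"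
    by (auto simp: coeff2_def image_iff) (metis coeff_0 le_degree)+
  then show ?thesis by (rule finite_subset) auto
qed

lemma germ_eval2_in_max_pow:
  assumes "\<And>i j. coeff2 f i j \<noteq> 0 \<Longrightarrow> n \<le> i + j"
  shows "germ_of (eval2 f) \<in> max_pow n"
proof -
  have "(\<Sum>(i, j)\<in>{(i, j). coeff2 f i j \<noteq> 0}. germ_const (coeff2 f i j) * (gX ^ i * gY ^ j)) \<in> max_pow n"
  proof (rule germ.subspace_sum[OF max_pow_subspace])
    fix p assume "p \<in> {(i, j). coeff2 f i j \<noteq> 0}"
    then have "n \<le> fst p + snd p" using assms by auto
    then have "gmon p \<in> max_pow n" using max_pow_mono max_pow_monomial by blast
    then show "(case p of (i, j) \<Rightarrow> germ_const (coeff2 f i j) * (gX ^ i * gY ^ j)) \<in> max_pow n"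
      by (simp add: case_prod_unfold germ.subspace_scale max_pow_subspace)
  qed
  then show ?thesis
    by (subst germ_eval2_eq_sum[OF finite_coeff2_support]) auto
qed

text \<open>On a line of constant weight the exponent of \<open>y\<close> determines that of
  \<open>x\<close>, so setting \<open>x = 1\<close> loses no information and homogenization recovers
  the polynomial.\<close>

lemma eval2_homogenize:
  assumes a: "a > 0" and h: "\<And>i j. coeff2 h i j \<noteq> 0 \<Longrightarrow> (i, j) \<in> weighted_set a b d" and b: "b > 0"
  shows "germ_of (eval2 h) = homogenize a b d (map_poly (\<lambda>c. poly c 1) h) gX gY" (is ?A)
    and "Polynomial.coeff (map_poly (\<lambda>c. poly c 1) h) j \<noteq> 0 \<Longrightarrow> \<exists>i. (i, j) \<in> weighted_set a b d"
proof -
  have by_sum: "germ_of (eval2 h) = (\<Sum>(i, j)\<in>weighted_set a b d. germ_const (coeff2 h i j) * (gX ^ i * gY ^ j))"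
    using finite_weighted_set[OF a b] h by (rule germ_eval2_eq_sum)
  show ?A
    unfolding homogenize_def by_sum
  proof (rule sum.cong, simp, clarify)
    fix i j assume ij: "(i, j) \<in> weighted_set a b d"
    have "Polynomial.coeff h j = Polynomial.monom (coeff2 h i j) i"
    proof (rule poly_eqI)
      fix i'
      have "coeff2 h i' j = 0" if "i' \<noteq> i"
        by (rule ccontr) (use h[of i' j] that ij a in \<open>auto simp: weighted_set_def\<close>)
      then show "Polynomial.coeff (Polynomial.coeff h j) i' = Polynomial.coeff (Polynomial.monom (coeff2 h i j) i) i'"
        by (auto simp: coeff2_def)
    qed
    then have "poly (Polynomial.coeff h j) 1 = coeff2 h i j"
      by (simp add: poly_monom)
    then show "germ_const (coeff2 h i j) * (gX ^ i * gY ^ j) =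
        germ_const (Polynomial.coeff (map_poly (\<lambda>c. poly c 1) h) j) * (gX ^ i * gY ^ j)"
      by (simp add: coeff_map_poly)
  qed
  assume "Polynomial.coeff (map_poly (\<lambda>c. poly c 1) h) j \<noteq> 0"
  then have "Polynomial.coeff h j \<noteq> 0" by (auto simp: coeff_map_poly)
  then obtain i where "coeff2 h i j \<noteq> 0" by (auto simp: coeff2_def poly_eq_iff)
  then show "\<exists>i. (i, j) \<in> weighted_set a b d" using h by blast
qed

text \<open>The counterpart for \<open>y = 1\<close>. Since polynomials in \<open>y\<close> have
  coefficients in \<open>x\<close>, this specialization is \<open>poly h 1\<close>; each of its
  coefficients is a sum over \<open>j\<close> with at most one nonzero term.\<close>

lemma eval2_homogenize_swap:
  assumes b: "b > 0" and h: "\<And>i j. coeff2 h i j \<noteq> 0 \<Longrightarrow> (i, j) \<in> weighted_set a b d" and a: "a > 0"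
  shows "germ_of (eval2 h) = homogenize b a d (poly h 1) gY gX" (is ?A)
    and "Polynomial.coeff (poly h 1) i \<noteq> 0 \<Longrightarrow> \<exists>j. (j, i) \<in> weighted_set b a d"
proof -
  have by_sum: "germ_of (eval2 h) = (\<Sum>(i, j)\<in>weighted_set a b d. germ_const (coeff2 h i j) * (gX ^ i * gY ^ j))"
    using finite_weighted_set[OF a b] h by (rule germ_eval2_eq_sum)
  have cf: "Polynomial.coeff (poly h 1) i = (\<Sum>j\<le>degree h. coeff2 h i j)" for i
    by (simp add: poly_altdef[of h] coeff_sum coeff2_def)
  have sw: "(j, i) \<in> weighted_set b a d \<longleftrightarrow> (i, j) \<in> weighted_set a b d" for i j
    by (auto simp: weighted_set_def)
  have "germ_of (eval2 h) = (\<Sum>(i, j)\<in>weighted_set a b d.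
      germ_const (Polynomial.coeff (poly h 1) i) * (gX ^ i * gY ^ j))"
    unfolding by_sum
  proof (rule sum.cong, simp, clarify)
    fix i j assume ij: "(i, j) \<in> weighted_set a b d"
    have "coeff2 h i j' = 0" if "j' \<noteq> j" for j'
      by (rule ccontr) (use h[of i j'] that ij b in \<open>auto simp: weighted_set_def\<close>)
    then have "Polynomial.coeff (poly h 1) i = (\<Sum>j'\<le>degree h. if j' = j then coeff2 h i j' else 0)"
      unfolding cf by (intro sum.cong) auto
    also have "\<dots> = coeff2 h i j"
      by (auto simp: coeff2_def coeff_eq_0)
    finally show "germ_const (coeff2 h i j) * (gX ^ i * gY ^ j) =
        germ_const (Polynomial.coeff (poly h 1) i) * (gX ^ i * gY ^ j)"
      by simp
  qed
  also have "\<dots> = homogenize b a d (poly h 1) gY gX"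
    unfolding homogenize_def
    by (rule sum.reindex_bij_witness[of _ prod.swap prod.swap]) (auto simp: sw mult_ac)
  finally show ?A .
  assume "Polynomial.coeff (poly h 1) i \<noteq> 0"
  then obtain j where "coeff2 h i j \<noteq> 0" unfolding cf by (meson sum.neutral)
  then show "\<exists>j. (j, i) \<in> weighted_set b a d" using h sw by blast
qed

text \<open>No point \<open>(1, y)\<close> or \<open>(x, 1)\<close> is the origin, so each pair of
  dehomogenizations is without common root and \<open>homogenize_nullstellensatz\<close>
  applies.\<close>

lemma monomial_power_in_ideal:
  assumes a: "a > 0" and b: "b > 0"
    and f: "\<And>i j. coeff2 f i j \<noteq> 0 \<Longrightarrow> (i, j) \<in> weighted_set a b e"
    and g: "\<And>i j. coeff2 g i j \<noteq> 0 \<Longrightarrow> (i, j) \<in> weighted_set a b e'"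
    and zero: "\<And>z. eval2 f z = 0 \<Longrightarrow> eval2 g z = 0 \<Longrightarrow> z = (0, 0)"
  shows "\<exists>N. \<exists>u\<in>carrier O2. \<exists>v\<in>carrier O2. gX ^ N = u * germ_of (eval2 f) + v * germ_of (eval2 g)"
    and "\<exists>N. \<exists>u\<in>carrier O2. \<exists>v\<in>carrier O2. gY ^ N = u * germ_of (eval2 f) + v * germ_of (eval2 g)"
proof -
  have 1: "poly (map_poly (\<lambda>c. poly c 1) h) y = eval2 h (1, y)" for h y
    by (induction h) (simp_all add: map_poly_pCons)
  have 2: "poly (poly h 1) x = eval2 h (x, 1)" for h x
    by (simp add: eval2_def one_pCons)
  show "\<exists>N. \<exists>u\<in>carrier O2. \<exists>v\<in>carrier O2. gX ^ N = u * germ_of (eval2 f) + v * germ_of (eval2 g)"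
  proof (rule homogenize_nullstellensatz[OF a b gX_in_O2 gY_in_O2 eval2_homogenize(2)[OF a f b] eval2_homogenize(2)[OF a g b]])
    show "\<not> (poly (map_poly (\<lambda>c. poly c 1) f) x = 0 \<and> poly (map_poly (\<lambda>c. poly c 1) g) x = 0)" for x
      unfolding 1 using zero[of "(1, x)"] by auto
  qed (auto simp flip: eval2_homogenize(1)[OF a f b] eval2_homogenize(1)[OF a g b])
  show "\<exists>N. \<exists>u\<in>carrier O2. \<exists>v\<in>carrier O2. gY ^ N = u * germ_of (eval2 f) + v * germ_of (eval2 g)"
  proof (rule homogenize_nullstellensatz[OF b a gY_in_O2 gX_in_O2 eval2_homogenize_swap(2)[OF b f a] eval2_homogenize_swap(2)[OF b g a]])
    show "\<not> (poly (poly f 1) x = 0 \<and> poly (poly g 1) x = 0)" for x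
      unfolding 2 using zero[of "(x, 1)"] by auto
  qed (auto simp flip: eval2_homogenize_swap(1)[OF b f a] eval2_homogenize_swap(1)[OF b g a])
qed

lemma eval2_weighted_scaling:
  assumes "a > 0" "b > 0" "\<And>i j. coeff2 f i j \<noteq> 0 \<Longrightarrow> (i, j) \<in> weighted_set a b e"
  shows "eval2 f (t ^ a * x, t ^ b * y) = t ^ e * eval2 f (x, y)"
proof -
  have "(t ^ a * x) ^ i * (t ^ b * y) ^ j = t ^ e * (x ^ i * y ^ j)" if "(i, j) \<in> weighted_set a b e" for i j
    using that by (auto simp: weighted_set_def power_mult_distrib power_add mult_ac simp flip: power_mult)
  moreover have "eval2 f z = (\<Sum>(i, j)\<in>weighted_set a b e. coeff2 f i j * (fst z ^ i * snd z ^ j))" for z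
    using finite_weighted_set[OF assms(1,2)] assms(3) by (rule eval2_eq_sum)
  ultimately show ?thesis
    by (auto simp: sum_distrib_left mult.left_commute intro!: sum.cong)
qed

text \<open>A nonzero common zero would be carried arbitrarily close to the origin by the weighted scaling.\<close>

lemma isolated_weighted_zero:
  assumes a: "a > 0" and b: "b > 0" and d: "d > 0"
    and f: "\<And>i j. coeff2 f i j \<noteq> 0 \<Longrightarrow> (i, j) \<in> weighted_set a b d"
    and fx: "\<And>i j. coeff2 (poly2_dx f) i j \<noteq> 0 \<Longrightarrow> (i, j) \<in> weighted_set a b e"
    and fy: "\<And>i j. coeff2 (pderiv f) i j \<noteq> 0 \<Longrightarrow> (i, j) \<in> weighted_set a b e'"
    and iso: "isolated_curve_singularity f"
    and z: "eval2 (poly2_dx f) z = 0" "eval2 (pderiv f) z = 0"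
  shows "z = (0, 0)"
proof (rule ccontr)
  assume nz: "z \<noteq> (0, 0)"
  obtain x y where xy: "z = (x, y)" by (cases z)
  let ?s = "\<lambda>t. (t ^ a * x, t ^ b * y)"
  have sing: "?s t \<in> singular_locus (eval2 f)" for t
  proof -
    have "eval2 (poly2_dx f) (?s t) = 0" "eval2 (pderiv f) (?s t) = 0"
      using z eval2_weighted_scaling[OF a b fx] eval2_weighted_scaling[OF a b fy] xy by simp_all
    \<comment> \<open>By Euler's identity \<open>f\<close> vanishes wherever both partial
      derivatives do.\<close>
    then show ?thesis
      using eval2_euler[OF d, of f a b "?s t"] f
      by (auto simp: singular_locus_def dx_eval2 dy_eval2 weighted_set_def)
  qed
  obtain T where T: "open T" "T \<inter> singular_locus (eval2 f) = {(0, 0)}"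
    using iso by (auto simp: isolated_curve_singularity_def isolated_in_def)
  have "(?s \<longlongrightarrow> ?s 0) (at 0)" by (intro tendsto_intros)
  moreover have "?s 0 \<in> T" using T a b by (auto simp: power_0_left)
  ultimately have "\<forall>\<^sub>F t in at 0. ?s t \<in> T"
    using T(1) topological_tendstoD by blast
  moreover have "\<forall>\<^sub>F t in at (0::complex). t \<noteq> 0" by (rule eventually_neq_at_within)
  ultimately have "\<forall>\<^sub>F t in at (0::complex). False"
  proof eventually_elim
    case (elim t)
    then have "?s t = (0, 0)" using sing T(2) by blast
    then show ?case using elim nz xy by auto
  qed
  then show False by simp
qed

section \<open>Dimension counts\<close>

lemma finite_codimI:
  assumes "max_pow N \<subseteq> I"
  shows "finite_codim I"
proof -
  have "carrier O2 \<subseteq> germ.span (gmon ` monomials 0 N \<union> I)"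
    using max_pow_span[of 0 N] germ.span_mono[of "gmon ` monomials 0 N \<union> max_pow N" "gmon ` monomials 0 N \<union> I"] assms
    by auto
  moreover have "gmon ` monomials 0 N \<subseteq> carrier O2"
    by (auto intro!: O2_closed gX_in_O2 gY_in_O2)
  ultimately show ?thesis
    unfolding finite_codim_def
    by (intro exI[of _ "gmon ` monomials 0 N"] conjI finite_imageI card_monomials(1))
qed

text \<open>A spanning set modulo \<open>J\<close> together with \<open>T\<close> spans modulo
  \<open>I\<close>. With \<open>I\<close> the smaller ideal, this bounds the gap between the two
  codimensions.\<close>

lemma codim_le_add_card:
  assumes "finite_codim J" "finite T" "T \<subseteq> carrier O2" "J \<subseteq> germ.span (T \<union> I)"
  shows "codim I \<le> codim J + card T"
proof -
  obtain B where B: "finite B" "card B = codim J" "B \<subseteq> carrier O2" "carrier O2 \<subseteq> germ.span (B \<union> J)"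
    using assms(1) by (rule codim_obtain)
  have "B \<union> J \<subseteq> germ.span (B \<union> T \<union> I)"
    using assms(4) germ.span_mono[of "T \<union> I" "B \<union> T \<union> I"] by (auto intro: germ.span_base)
  then have "germ.span (B \<union> J) \<subseteq> germ.span (B \<union> T \<union> I)"
    by (rule germ.span_minimal) (rule germ.subspace_span)
  then have "codim I \<le> card (B \<union> T)"
    using B assms by (intro codim_le) auto
  also have "\<dots> \<le> codim J + card T" using card_Un_le[of B T] B(2) by simp
  finally show ?thesis .
qed

text \<open>A spanning set modulo \<open>I\<close> together with \<open>S\<close> spans modulo
  \<open>max_pow m\<close>, where the \<open>m (m + 1) / 2\<close> monomials of degree less than
  \<open>m\<close> are independent.\<close>

lemma codim_ge:
  assumes "finite_codim I" "finite S" "I \<subseteq> germ.span (S \<union> max_pow m)"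
  shows "m * (m + 1) div 2 \<le> codim I + card S"
proof -
  obtain B where B: "finite B" "card B = codim I" "B \<subseteq> carrier O2" "carrier O2 \<subseteq> germ.span (B \<union> I)"
    using assms(1) by (rule codim_obtain)
  have "B \<union> I \<subseteq> germ.span (B \<union> S \<union> max_pow m)"
    using assms(3) germ.span_mono[of "S \<union> max_pow m" "B \<union> S \<union> max_pow m"] by (auto intro: germ.span_base)
  then have sp: "germ.span (B \<union> I) \<subseteq> germ.span (B \<union> S \<union> max_pow m)"
    by (rule germ.span_minimal) (rule germ.subspace_span)
  have "card (monomials 0 m) \<le> card (B \<union> S)"
  proof (rule germ.card_le_card_spanning_mod[where v = gmon])
    show "finite (B \<union> S)" using B assms by simp
    show "gmon p \<in> germ.span (B \<union> S \<union> max_pow m)" for p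
      using sp B(4) by (rule_tac subsetD[OF order_trans]) (auto intro!: O2_closed gX_in_O2 gY_in_O2)
    show "\<forall>p\<in>monomials 0 m. c p = 0"
      if "(\<Sum>p\<in>monomials 0 m. germ_const (c p) * gmon p) \<in> max_pow m" for c
      using monomials_independent_mod[OF card_monomials(1) order_refl that] .
  qed (rule max_pow_subspace, rule card_monomials)
  also have "\<dots> \<le> codim I + card S" using card_Un_le[of B S] B(2) by simp
  finally show ?thesis by (simp add: card_monomials)
qed

text \<open>An explicit form of the product of the \<open>k\<close>-th power of the maximal ideal
  with the ideal generated by \<open>P\<close> and \<open>Q\<close>, as
  \<open>max_pow_genideal\<close> shows: one pair of multipliers replaces finite sums of
  products.\<close>

definition pair_ideal :: "nat \<Rightarrow> germ \<Rightarrow> germ \<Rightarrow> germ set" where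
  "pair_ideal k P Q = {a * P + b * Q |a b. a \<in> max_pow k \<and> b \<in> max_pow k}"

lemma pair_idealI: "a \<in> max_pow k \<Longrightarrow> b \<in> max_pow k \<Longrightarrow> a * P + b * Q \<in> pair_ideal k P Q"
  by (auto simp: pair_ideal_def)

lemma ideal_pair_ideal:
  assumes "P \<in> carrier O2" "Q \<in> carrier O2"
  shows "ideal (pair_ideal k P Q) O2"
proof (rule ideal_O2I)
  show "pair_ideal k P Q \<subseteq> carrier O2"
    using assms max_pow_carrier[of k] by (auto simp: pair_ideal_def intro!: O2_closed)
  show "0 \<in> pair_ideal k P Q"
    using pair_idealI[of 0 k 0 P Q] max_pow_0_mem by simp
  show "g + h \<in> pair_ideal k P Q" if gh: "g \<in> pair_ideal k P Q" "h \<in> pair_ideal k P Q" for g h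
  proof -
    obtain a b a' b' where "g = a * P + b * Q" "h = a' * P + b' * Q"
      "a \<in> max_pow k" "b \<in> max_pow k" "a' \<in> max_pow k" "b' \<in> max_pow k"
      using gh by (auto simp: pair_ideal_def)
    then show ?thesis
      using pair_idealI[of "a + a'" k "b + b'" P Q] by (simp add: max_pow_add algebra_simps)
  qed
  show "h * g \<in> pair_ideal k P Q" if hg: "h \<in> carrier O2" "g \<in> pair_ideal k P Q" for g h
  proof -
    obtain a b where "g = a * P + b * Q" "a \<in> max_pow k" "b \<in> max_pow k"
      using hg by (auto simp: pair_ideal_def)
    moreover have "h * (a * P + b * Q) = (h * a) * P + (h * b) * Q"
      by (simp add: algebra_simps)
    ultimately show ?thesis
      using pair_idealI[of "h * a" k "h * b" P Q] hg(1) by (simp only: max_pow_mult_left)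
  qed
qed

lemma max_pow_genideal:
  assumes "P \<in> carrier O2" "Q \<in> carrier O2"
  shows "max_pow k \<cdot>\<^bsub>O2\<^esub> (Idl\<^bsub>O2\<^esub> {P, Q}) = pair_ideal k P Q"
proof -
  interpret pair: ideal "pair_ideal k P Q" O2 by (rule ideal_pair_ideal[OF assms])
  have PQ: "{P, Q} \<subseteq> Idl\<^bsub>O2\<^esub> {P, Q}" using assms by (intro O2.genideal_self) auto
  have "{P, Q} \<subseteq> pair_ideal 0 P Q"
    using pair_idealI[of 1 0 0 P Q] pair_idealI[of 0 0 1 P Q] by (auto simp: O2_closed)
  then have Idl: "Idl\<^bsub>O2\<^esub> {P, Q} \<subseteq> pair_ideal 0 P Q"
    by (intro O2.genideal_minimal ideal_pair_ideal assms)
  show ?thesis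
  proof
    show "max_pow k \<cdot>\<^bsub>O2\<^esub> (Idl\<^bsub>O2\<^esub> {P, Q}) \<subseteq> pair_ideal k P Q"
    proof
      fix z assume "z \<in> max_pow k \<cdot>\<^bsub>O2\<^esub> (Idl\<^bsub>O2\<^esub> {P, Q})"
      then show "z \<in> pair_ideal k P Q"
      proof (induction rule: ideal_prod.induct)
        case (prod i j)
        then obtain u v where uv: "j = u * P + v * Q" "u \<in> carrier O2" "v \<in> carrier O2"
          using Idl by (auto simp: pair_ideal_def)
        then have "i \<otimes>\<^bsub>O2\<^esub> j = (u * i) * P + (v * i) * Q" by (simp add: algebra_simps)
        also have "\<dots> \<in> pair_ideal k P Q"
          using uv prod by (intro pair_idealI max_pow_mult_left)
        finally show ?case .
      next
        case (sum s1 s2)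
        then show ?case by (intro pair.a_closed)
      qed
    qed
    show "pair_ideal k P Q \<subseteq> max_pow k \<cdot>\<^bsub>O2\<^esub> (Idl\<^bsub>O2\<^esub> {P, Q})"
    proof
      fix z assume "z \<in> pair_ideal k P Q"
      then obtain a b where ab: "z = a \<otimes>\<^bsub>O2\<^esub> P \<oplus>\<^bsub>O2\<^esub> b \<otimes>\<^bsub>O2\<^esub> Q" "a \<in> max_pow k" "b \<in> max_pow k"
        by (auto simp: pair_ideal_def)
      show "z \<in> max_pow k \<cdot>\<^bsub>O2\<^esub> (Idl\<^bsub>O2\<^esub> {P, Q})"
        unfolding ab(1) using PQ ab by (intro ideal_prod.sum ideal_prod.prod) auto
    qed
  qed
qed

text \<open>A monomial of degree \<open>k + A + B\<close> is divisible by \<open>x^A\<close> or by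
  \<open>y^B\<close> with a cofactor of degree at least \<open>k\<close>. The induction realizes
  this for germs by peeling off one coordinate at a time: the \<open>gX\<close> part lowers
  \<open>A\<close>, the \<open>gY\<close> part lowers \<open>B\<close>.\<close>

lemma max_pow_decompose:
  assumes "g \<in> max_pow (k + A + B)"
  shows "\<exists>a\<in>max_pow k. \<exists>b\<in>max_pow k. g = gX ^ A * a + gY ^ B * b"
  using assms
proof (induction "A + B" arbitrary: A B g)
  case 0
  then show ?case using max_pow_0_mem[of k] by (intro bexI[of _ g] bexI[of _ 0]) auto
next
  case (Suc m)
  show ?case
  proof (cases "A = 0 \<or> B = 0")
    case True
    have "g \<in> max_pow k" using Suc.prems max_pow_mono[of k "k + A + B"] by auto
    then show ?thesis using True max_pow_0_mem[of k]
      by (metis add.right_neutral add.left_neutral mult_1 mult_zero_right power_0)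
  next
    case False
    then obtain A' B' where AB: "A = Suc A'" "B = Suc B'" by (metis not0_implies_Suc)
    have "g \<in> max_pow (Suc (k + A' + B))" using Suc.prems AB by (simp del: max_pow.simps)
    then obtain a b where ab: "g = gX * a + gY * b" "a \<in> max_pow (k + A' + B)" "b \<in> max_pow (k + A' + B)"
      by auto
    obtain a1 a2 where a: "a1 \<in> max_pow k" "a2 \<in> max_pow k" "a = gX ^ A' * a1 + gY ^ B * a2"
      using Suc.hyps(1)[of A' B a] Suc.hyps(2) ab AB by auto
    have "b \<in> max_pow (k + A + B')" using ab AB by simp
    then obtain b1 b2 where b: "b1 \<in> max_pow k" "b2 \<in> max_pow k" "b = gX ^ A * b1 + gY ^ B' * b2"
      using Suc.hyps(1)[of A B' b] Suc.hyps(2) AB by auto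
    have "g = gX ^ A * (a1 + gY * b1) + gY ^ B * (gX * a2 + b2)"
      by (simp add: ab(1) a(3) b(3) AB algebra_simps)
    moreover have "a1 + gY * b1 \<in> max_pow k" "gX * a2 + b2 \<in> max_pow k"
      using a b by (auto intro!: max_pow_add max_pow_mult_left gX_in_O2 gY_in_O2)
    ultimately show ?thesis by blast
  qed
qed

text \<open>Substituting the two identities into \<open>max_pow_decompose\<close> keeps the
  multipliers in \<open>max_pow k\<close>. Finiteness of the codimensions rests on this
  inclusion.\<close>

lemma max_pow_subset_pair_ideal:
  assumes "gX ^ A = u * P + v * Q" "gY ^ B = u' * P + v' * Q"
    and "u \<in> carrier O2" "v \<in> carrier O2" "u' \<in> carrier O2" "v' \<in> carrier O2"
  shows "max_pow (k + A + B) \<subseteq> pair_ideal k P Q"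
proof
  fix g assume "g \<in> max_pow (k + A + B)"
  then obtain a b where ab: "a \<in> max_pow k" "b \<in> max_pow k" "g = gX ^ A * a + gY ^ B * b"
    using max_pow_decompose by blast
  then have "g = (u * a + u' * b) * P + (v * a + v' * b) * Q"
    using assms by (simp add: algebra_simps)
  also have "\<dots> \<in> pair_ideal k P Q"
    using ab assms by (intro pair_idealI max_pow_add max_pow_mult_left)
  finally show "g \<in> pair_ideal k P Q" .
qed

text \<open>Multipliers can be reduced modulo \<open>max_pow n\<close>: as \<open>P\<close> and
  \<open>Q\<close> lie in \<open>max_pow n\<close>, the error falls into
  \<open>max_pow (2 * n)\<close>.\<close>

lemma pair_ideal_span:
  assumes "P \<in> max_pow n" "Q \<in> max_pow n" "k \<le> n"
  shows "pair_ideal k P Q \<subseteq>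
    germ.span (((\<lambda>p. P * gmon p) ` monomials k n \<union> (\<lambda>p. Q * gmon p) ` monomials k n) \<union> max_pow (2 * n))"
proof -
  have R: "R * a \<in> germ.span (S \<union> max_pow (2 * n))"
    if a: "a \<in> max_pow k" and R: "R \<in> max_pow n" and S: "(\<lambda>p. R * gmon p) ` monomials k n \<subseteq> S" for R a S
  proof -
    have "a \<in> germ.span (gmon ` monomials k n \<union> max_pow n)"
      using max_pow_span[OF assms(3)] a by auto
    then have "R * a \<in> germ.span ((*) R ` (gmon ` monomials k n \<union> max_pow n))"
      by (rule span_mult)
    moreover have "(*) R ` (gmon ` monomials k n \<union> max_pow n) \<subseteq> S \<union> max_pow (2 * n)"
      using S max_pow_mult[OF R, of _ n] by (auto simp: image_Un image_image mult_2)
    ultimately show ?thesis using germ.span_mono by blast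
  qed
  show ?thesis
  proof
    fix z assume "z \<in> pair_ideal k P Q"
    then obtain a b where ab: "z = P * a + Q * b" "a \<in> max_pow k" "b \<in> max_pow k"
      by (auto simp: pair_ideal_def mult.commute)
    show "z \<in> germ.span (((\<lambda>p. P * gmon p) ` monomials k n \<union> (\<lambda>p. Q * gmon p) ` monomials k n) \<union> max_pow (2 * n))"
      unfolding ab(1) by (intro germ.span_add R ab assms) auto
  qed
qed

text \<open>There are \<open>n (2n + 1)\<close> monomials of degree less than \<open>2n\<close>, and
  the ideal accounts for at most \<open>2 * card (monomials k n) = n (n + 1) - k (k + 1)\<close> of
  these dimensions; the difference is \<open>n^2 + k^2 + k\<close>.\<close>

lemma codim_pair_ideal_ge:
  assumes "P \<in> max_pow n" "Q \<in> max_pow n" "k \<le> n" "finite_codim (pair_ideal k P Q)"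
  shows "n * n + k * k + k \<le> codim (pair_ideal k P Q)"
proof -
  let ?m = "monomials k n"
  let ?S = "(\<lambda>p. P * gmon p) ` ?m \<union> (\<lambda>p. Q * gmon p) ` ?m"
  have "(2 * n) * (2 * n + 1) div 2 \<le> codim (pair_ideal k P Q) + card ?S"
    using assms card_monomials(1) by (intro codim_ge pair_ideal_span) auto
  moreover have "card ?S \<le> card ?m + card ?m"
    by (intro order_trans[OF card_Un_le] add_mono card_image_le card_monomials)
  moreover have "2 * card ?m + k * (k + 1) = n * (n + 1)"
  proof -
    have "k * (k + 1) \<le> n * (n + 1)" using assms(3) by (intro mult_le_mono) auto
    moreover have "2 * (n * (n + 1) div 2) = n * (n + 1)" "2 * (k * (k + 1) div 2) = k * (k + 1)"
      by simp_all
    ultimately show ?thesis using card_monomials(3)[OF assms(3)] by linarith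
  qed
  moreover have "(2 * n) * (2 * n + 1) div 2 = 2 * (n * n) + n" by (simp add: algebra_simps)
  ultimately show ?thesis by (simp add: algebra_simps)
qed

text \<open>Multiplying the weight equation by the product of the two denominators makes the weights
  integral, so that they can serve as exponents in the scaling \<open>t ^ a\<close>,
  \<open>t ^ b\<close>.\<close>

lemma quasi_homogeneous_weights:
  assumes "quasi_homogeneous f"
  obtains a b d :: nat where "a > 0" "b > 0" "d > 0"
    "\<And>i j. coeff2 f i j \<noteq> 0 \<Longrightarrow> a * i + b * j = d"
proof -
  obtain w1 w2 :: rat where w: "w1 > 0" "w2 > 0"
    "\<And>i j. coeff2 f i j \<noteq> 0 \<Longrightarrow> w1 * of_nat i + w2 * of_nat j = 1"
    using assms unfolding quasi_homogeneous_def by blast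
  have nat_frac: "\<exists>p q. p > 0 \<and> q > 0 \<and> w = of_nat p / of_nat q" if "w > 0" for w :: rat
  proof -
    obtain p q where pq: "quotient_of w = (p, q)" by fastforce
    then have w: "w = of_int p / of_int q" and q: "q > 0"
      by (auto dest: quotient_of_div quotient_of_denom_pos)
    then have "p > 0" using that by (simp add: zero_less_divide_iff)
    then show ?thesis using w q by (intro exI[of _ "nat p"] exI[of _ "nat q"]) simp
  qed
  obtain p1 q1 p2 q2 where pq: "p1 > 0" "q1 > 0" "w1 = of_nat p1 / of_nat q1" "p2 > 0" "q2 > 0" "w2 = of_nat p2 / of_nat q2"
    using nat_frac[OF w(1)] nat_frac[OF w(2)] by blast
  have "(p1 * q2) * i + (p2 * q1) * j = q1 * q2" if "coeff2 f i j \<noteq> 0" for i j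
  proof -
    have "of_nat ((p1 * q2) * i + (p2 * q1) * j) = (of_nat (q1 * q2) :: rat)"
      using w(3)[OF that] pq by (simp add: field_simps)
    then show ?thesis by (simp only: of_nat_eq_iff)
  qed
  then show ?thesis using that[of "p1 * q2" "p2 * q1" "q1 * q2"] pq by simp
qed

lemma coeff2_zero_at_origin: "coeff2 f 0 0 = eval2 f (0, 0)"
  by (simp add: coeff2_def eval2_def poly_0_coeff_0)

theorem theorem7p1:
  fixes f :: "complex poly poly" and k :: nat
  assumes "isolated_curve_singularity f"
    and "quasi_homogeneous f"
    and "k < vanishing_order f"
  shows "real (milnor k (germ_of (eval2 f))) / real (tjurina k (germ_of (eval2 f))) < 4 / 3"
proof -
  obtain a b d :: nat where abd: "a > 0" "b > 0" "d > 0"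
    and hom: "\<And>i j. coeff2 f i j \<noteq> 0 \<Longrightarrow> a * i + b * j = d"
    using assms(2) by (rule quasi_homogeneous_weights) blast
  have f: "(i, j) \<in> weighted_set a b d" if "coeff2 f i j \<noteq> 0" for i j
    using hom[OF that] by (simp add: weighted_set_def)
  \<comment> \<open>The subtraction is not truncated when it matters: a nonzero coefficient gives
    \<open>a * Suc i + b * j = d\<close>, hence \<open>a \<le> d\<close>.\<close>
  have fx: "(i, j) \<in> weighted_set a b (d - a)" if "coeff2 (poly2_dx f) i j \<noteq> 0" for i j
    using hom[of "Suc i" j] that by (auto simp: weighted_set_def coeff2_poly2_dx)
  have fy: "(i, j) \<in> weighted_set a b (d - b)" if "coeff2 (pderiv f) i j \<noteq> 0" for i j
    using hom[of i "Suc j"] that by (auto simp: weighted_set_def coeff2_pderiv)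
  define P Q F where "P = germ_of (eval2 (poly2_dx f))" and "Q = germ_of (eval2 (pderiv f))"
    and "F = germ_of (eval2 f)"
  have dxy: "germ_dx F = P" "germ_dy F = Q"
    by (simp_all add: P_def Q_def F_def germ_dx.abs_eq germ_dy.abs_eq dx_eval2 dy_eval2)
  have zero: "z = (0, 0)" if "eval2 (poly2_dx f) z = 0" "eval2 (pderiv f) z = 0" for z
    using abd f fx fy assms(1) that by (rule isolated_weighted_zero)
  define n where "n = vanishing_order f - 1"
  have "(0, 0) \<in> singular_locus (eval2 f)"
    using assms(1) by (auto simp: isolated_curve_singularity_def isolated_in_def)
  then have low: "coeff2 f 0 0 = 0" "coeff2 f (Suc 0) 0 = 0" "coeff2 f 0 (Suc 0) = 0"
    using coeff2_poly2_dx[of f 0 0] coeff2_pderiv[of f 0 0]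
    by (auto simp: singular_locus_def dx_eval2 dy_eval2 coeff2_zero_at_origin)
  have order: "Suc n \<le> i + j" if "coeff2 f i j \<noteq> 0" for i j
    using assms(3) Least_le[of "\<lambda>n. \<exists>i j. i + j = n \<and> coeff2 f i j \<noteq> 0" "i + j"] that
    by (auto simp: n_def vanishing_order_def)
  have n: "n \<ge> 1" "k \<le> n"
  proof -
    \<comment> \<open>For \<open>f = 0\<close> both derivatives would vanish at
      \<open>(1, 1)\<close>. With \<open>f\<close> nonzero, the \<open>LEAST\<close> in
      \<open>vanishing_order\<close> is attained.\<close>
    have "f \<noteq> 0" using zero[of "(1, 1)"] by (auto simp: poly2_dx_def)
    then have "\<exists>n i j. i + j = n \<and> coeff2 f i j \<noteq> 0"
      by (auto simp: coeff2_def poly_eq_iff)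
    then have "\<exists>i j. i + j = vanishing_order f \<and> coeff2 f i j \<noteq> 0"
      unfolding vanishing_order_def by (rule LeastI_ex)
    then obtain i j where ij: "i + j = vanishing_order f" "coeff2 f i j \<noteq> 0" by blast
    have "vanishing_order f \<ge> 2"
    proof (rule ccontr)
      assume "\<not> vanishing_order f \<ge> 2"
      then have "(i, j) = (0, 0) \<or> (i, j) = (Suc 0, 0) \<or> (i, j) = (0, Suc 0)" using ij(1) by auto
      then show False using ij(2) low by auto
    qed
    then show "n \<ge> 1" "k \<le> n" using assms(3) by (auto simp: n_def)
  qed
  have PQ: "P \<in> max_pow n" "Q \<in> max_pow n"
    unfolding P_def Q_def using order[of "Suc _"] order[of _ "Suc _"]
    by (auto intro!: germ_eval2_in_max_pow simp: coeff2_poly2_dx coeff2_pderiv)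
  have F1: "F \<in> max_pow 1"
    unfolding F_def using order by (intro germ_eval2_in_max_pow) fastforce
  have O2: "P \<in> carrier O2" "Q \<in> carrier O2" "F \<in> carrier O2"
    using PQ F1 max_pow_carrier by blast+
  have euler: "F = germ_const (of_nat a / of_nat d) * gX * P + germ_const (of_nat b / of_nat d) * gY * Q"
  proof -
    have "eval2 f = (\<lambda>z. of_nat a / of_nat d * fst z * eval2 (poly2_dx f) z +
        of_nat b / of_nat d * snd z * eval2 (pderiv f) z)"
      using eval2_euler[OF abd(3) hom] by blast
    then show ?thesis
      by (simp add: F_def P_def Q_def gX_def gY_def germ_const.abs_eq times_germ.abs_eq plus_germ.abs_eq)
  qed
  define E where "E = pair_ideal k P Q"
  define J where "J = E <+>\<^bsub>O2\<^esub> Idl\<^bsub>O2\<^esub> {F}"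
  have E_eq: "max_jacobian k F = E"
    by (simp add: max_jacobian_def jacobian_ideal_def dxy max_ideal_power max_pow_genideal O2 E_def)
  have idE: "ideal E O2" unfolding E_def by (rule ideal_pair_ideal) fact+
  have idF: "ideal (Idl\<^bsub>O2\<^esub> {F}) O2" using O2 by (intro O2.genideal_ideal) auto
  have idJ: "ideal J O2" unfolding J_def by (rule O2.add_ideals[OF idE idF])
  have EJ: "E \<subseteq> J"
  proof
    fix g assume "g \<in> E"
    moreover have "0 \<in> Idl\<^bsub>O2\<^esub> {F}" using additive_subgroup.zero_closed[OF ideal.axioms(1)[OF idF]] by simp
    ultimately have "g \<oplus>\<^bsub>O2\<^esub> 0 \<in> J" unfolding J_def set_add_def' by blast
    then show "g \<in> J" by simp
  qed
  have JE: "\<exists>e\<in>E. \<exists>r\<in>carrier O2. g = e + F * r" if g: "g \<in> J" for g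
  proof -
    obtain e h where "e \<in> E" "h \<in> Idl\<^bsub>O2\<^esub> {F}" "g = e + h"
      using g unfolding J_def set_add_def' O2_ops by blast
    then have "e \<in> E" "h \<in> PIdl\<^bsub>O2\<^esub> F" "g = e + h"
      unfolding O2.cgenideal_eq_genideal[OF O2(3)] .
    then show ?thesis by (auto simp: cgenideal_def mult.commute)
  qed
  have E1: "E \<subseteq> max_pow 1"
  proof
    fix g assume "g \<in> E"
    then obtain u v where "g = u * P + v * Q" "u \<in> max_pow k" "v \<in> max_pow k"
      by (auto simp: E_def pair_ideal_def)
    moreover have "P \<in> max_pow 1" "Q \<in> max_pow 1" using PQ max_pow_mono[OF n(1)] by auto
    ultimately show "g \<in> max_pow 1" using max_pow_carrier[of k]
      by (auto intro!: max_pow_add max_pow_mult_left simp del: max_pow.simps)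
  qed
  have J1: "J \<subseteq> max_pow 1"
  proof
    fix g assume "g \<in> J"
    then obtain e r where "e \<in> E" "r \<in> carrier O2" "g = e + F * r" using JE by blast
    then have "e \<in> E" "r \<in> carrier O2" "g = e + r * F" by (simp_all add: mult.commute)
    then show "g \<in> max_pow 1" using E1 F1
      by (auto intro!: max_pow_add max_pow_mult_left simp del: max_pow.simps)
  qed
  \<comment> \<open>Properness of both ideals, which \<open>quot_dim_eq_codim\<close>
    requires.\<close>
  have "1 \<notin> max_pow 1" unfolding max_ideal_eq[symmetric] by (simp add: max_ideal_def)
  then have one: "1 \<notin> E" "1 \<notin> J" using E1 J1 by blast+
  obtain A B u v u' v' where "gX ^ A = u * P + v * Q" "gY ^ B = u' * P + v' * Q"
    "u \<in> carrier O2" "v \<in> carrier O2" "u' \<in> carrier O2" "v' \<in> carrier O2"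
    using monomial_power_in_ideal[OF abd(1,2) fx fy zero] unfolding P_def Q_def by blast
  then have "max_pow (k + A + B) \<subseteq> E" unfolding E_def by (rule max_pow_subset_pair_ideal)
  then have finE: "finite_codim E" and finJ: "finite_codim J"
    using EJ by (blast intro: finite_codimI)+
  \<comment> \<open>Modulo \<open>E\<close>, only multiples of \<open>F\<close> by monomials of
    degree less than \<open>k - 1\<close> survive. For \<open>k = 0\<close> the subtraction is
    truncated, there are no such monomials, and \<open>J\<close> coincides with
    \<open>E\<close>.\<close>
  have "J \<subseteq> germ.span ((\<lambda>p. F * gmon p) ` monomials 0 (k - 1) \<union> E)"
  proof
    fix g assume "g \<in> J"
    then obtain e r where er: "e \<in> E" "r \<in> carrier O2" "g = e + F * r" using JE by blast
    have "F * m \<in> E" if m: "m \<in> max_pow (k - 1)" for m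
    proof -
      have "max_pow (Suc (k - 1)) \<subseteq> max_pow k" by (rule max_pow_mono) simp
      then have Xm: "gX * m \<in> max_pow k" "gY * m \<in> max_pow k"
        using max_pow_gX[OF m] max_pow_gY[OF m] by (blast intro: subsetD)+
      \<comment> \<open>The factor \<open>gX\<close> or \<open>gY\<close> in Euler's identity
        supplies the one degree that \<open>m\<close> lacks.\<close>
      have "F * m = germ_const (of_nat a / of_nat d) * (gX * m) * P + germ_const (of_nat b / of_nat d) * (gY * m) * Q"
        by (simp add: euler algebra_simps)
      also have "\<dots> \<in> E"
        unfolding E_def by (intro pair_idealI max_pow_mult_left O2_const Xm)
      finally show ?thesis .
    qed
    then have "(*) F ` (gmon ` monomials 0 (k - 1) \<union> max_pow (k - 1)) \<subseteq>
        (\<lambda>p. F * gmon p) ` monomials 0 (k - 1) \<union> E"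
      by (auto simp: image_Un image_image)
    moreover have "F * r \<in> germ.span ((*) F ` (gmon ` monomials 0 (k - 1) \<union> max_pow (k - 1)))"
      using max_pow_span[of 0 "k - 1"] er(2) by (intro span_mult) auto
    ultimately have "F * r \<in> germ.span ((\<lambda>p. F * gmon p) ` monomials 0 (k - 1) \<union> E)"
      using germ.span_mono by blast
    then show "g \<in> germ.span ((\<lambda>p. F * gmon p) ` monomials 0 (k - 1) \<union> E)"
      unfolding er(3) using er(1) by (intro germ.span_add) (auto intro: germ.span_base)
  qed
  then have "codim E \<le> codim J + card ((\<lambda>p. F * gmon p) ` monomials 0 (k - 1))"
    using finJ card_monomials(1) O2
    by (intro codim_le_add_card) (auto intro!: O2_closed gX_in_O2 gY_in_O2)
  also have "\<dots> \<le> codim J + card (monomials 0 (k - 1))"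
    by (intro add_left_mono card_image_le card_monomials)
  finally have upper: "codim E \<le> codim J + (k - 1) * (k - 1 + 1) div 2"
    by (simp only: card_monomials)
  have lower: "n * n + k * k + k \<le> codim E"
    using codim_pair_ideal_ge[OF PQ n(2)] finE by (simp add: E_def)
  \<comment> \<open>For \<open>k = 0\<close> the gap is zero and \<open>codim E\<close> is at least
    \<open>n^2 > 0\<close>. For \<open>k = l + 1\<close>, four times the gap is at most
    \<open>2 l (l + 1) = 2 k^2 - 2 k\<close>, which is less than \<open>2 k^2 + k\<close>, a lower
    bound for \<open>codim E\<close> because \<open>k \<le> n\<close>.\<close>
  have "3 * codim E < 4 * codim J"
  proof (cases k)
    case 0
    then show ?thesis using upper lower n(1) by (simp; cases n; simp)
  next
    case (Suc l)
    have "2 * (l * (l + 1) div 2) = l * (l + 1)" by simp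
    then have "4 * codim E \<le> 4 * codim J + 2 * (l * (l + 1))" using upper Suc by simp
    moreover have "2 * (l * (l + 1)) < codim E"
    proof -
      have "k * k \<le> n * n" using n(2) by (intro mult_le_mono)
      then show ?thesis using lower Suc by (simp add: algebra_simps)
    qed
    ultimately show ?thesis by linarith
  qed
  moreover have "milnor k F = codim E" "tjurina k F = codim J"
    using quot_dim_eq_codim[OF idE one(1) finE] quot_dim_eq_codim[OF idJ one(2) finJ]
    by (simp_all add: milnor_def tjurina_def E_eq J_def)
  ultimately have "3 * real (milnor k F) < 4 * real (tjurina k F)" by linarith
  \<comment> \<open>The strict inequality forces \<open>tjurina k F\<close> to be positive, so the
    quotient is a genuine one.\<close>
  then have "real (milnor k F) / real (tjurina k F) < 4 / 3"
    by (simp add: field_simps)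
  then show ?thesis by (simp add: F_def)
qed

end
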